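(* Let $l\in\mathbb{Z}$ and let $g=h^4(t)(dt^2+dy^2)$ be an $S^1$-invariant metric on the two-dimensional torus $T^2$ with the trivial spin structure. Let $\lambda_1^2(g,l)$ be the first eigenvalue of the square of the Dirac operator such that its eigenspace $E(\lambda_1^2(g,l))$ contains the $S^1$-representation $\Sigma(l)$. Then the inequality $$\lambda_1^2(g,l)\le\frac{\displaystyle\int_0^1\frac{(2\pi l\varphi(t)-\varphi'(t))^2}{h^2(t)}\,dt}{\displaystyle\int_0^1h^2(t)\varphi^2(t)\,dt}$$ holds for any real-valued smooth $1$-periodic function $\varphi$ that is not identically zero.
   Context: $T^2=\mathbb{R}^2/\mathbb{Z}^2$ with coordinates $0\le t\le1$, $0\le y\le1$; $h$ is a positive smooth $1$-periodic function of $t$. The group $S^1$ acts isometrically by translations in $y$; $\Sigma(l)$ is the one-dimensional $S^1$-representation of weight $l$. $D_g^2$ preserves the splitting $S=S^+\oplus S^-$ of the spinor bundle and has the same eigenvalues on both parts; eigenspaces of $D_g^2$ are taken in the space of sections of $S^+$. A section of $S^+$ of weight $l$ is given by a function $A(t)e^{2\pi i l y}$, and it is an eigenspinor of $D_g^2$ with eigenvalue $\lambda^2$ iff $A$ is a nontrivial $1$-periodic solution of $$-A''(t)=\Bigl\{\lambda^2 h^4(t)+\frac{h(t)h''(t)-2(h'(t))^2}{h^2(t)}-4\pi^2l^2+4\pi l\,\frac{h'(t)}{h(t)}\Bigr\}A(t).$$ Thus $\lambda_1^2(g,l)$ is the smallest number $\lambda^2\geq 0$ for which this equation has a nontrivial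 $1$-periodic solution. *)

theory Defs
  imports "HOL-Analysis.Analysis"
begin

text \<open>\<open>C\<^sup>\<infinity>\<close> on the whole space: all iterated directional derivatives exist and are
  Frechet differentiable.\<close>

definition dir_deriv ::
  "'a::euclidean_space \<Rightarrow> ('a \<Rightarrow> 'b::real_normed_vector) \<Rightarrow> 'a \<Rightarrow> 'b" where
  "dir_deriv v f x = frechet_derivative f (at x) v"

definition smooth :: "('a::euclidean_space \<Rightarrow> 'b::real_normed_vector) \<Rightarrow> bool" where
  "smooth f \<longleftrightarrow> (\<forall>vs x. foldr dir_deriv vs f differentiable (at x))"

text \<open>Points of the universal cover of the torus are pairs \<open>(t, y)\<close>; objects on the torus are
  1-periodic objects on the cover. Tangent vectors are also pairs, and a metric assigns to each
  point a bilinear form.\<close>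

type_synonym point = "real \<times> real"
type_synonym vfield = "point \<Rightarrow> real \<times> real"
type_synonym metric = "point \<Rightarrow> real \<times> real \<Rightarrow> real \<times> real \<Rightarrow> real"
type_synonym spinor_field = "point \<Rightarrow> complex ^ 2"

definition lie_bracket :: "vfield \<Rightarrow> vfield \<Rightarrow> vfield" where
  "lie_bracket X Y p = dir_deriv (X p) Y p - dir_deriv (Y p) X p"

text \<open>\<open>levi_civita g X Y Z\<close> is the function \<open>g(\<nabla>\<^bsub>X\<^esub> Y, Z)\<close>, given by the Koszul formula.\<close>

definition levi_civita :: "metric \<Rightarrow> vfield \<Rightarrow> vfield \<Rightarrow> vfield \<Rightarrow> point \<Rightarrow> real" where
  "levi_civita g X Y Z p =
    (dir_deriv (X p) (\<lambda>q. g q (Y q) (Z q)) p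
     + dir_deriv (Y p) (\<lambda>q. g q (Z q) (X q)) p
     - dir_deriv (Z p) (\<lambda>q. g q (X q) (Y q)) p
     + g p (lie_bracket X Y p) (Z p)
     - g p (lie_bracket Y Z p) (X p)
     + g p (lie_bracket Z X p) (Y p)) / 2"

text \<open>Clifford multiplication by the two vectors of an oriented orthonormal frame, with the
  convention \<open>v \<cdot> v = - |v|\<^sup>2\<close>. The bundle \<open>S\<^sup>+\<close> is the \<open>+1\<close> eigenspace of \<open>\<i> e\<^sub>1 e\<^sub>2\<close>, which for
  these matrices consists of the vectors with vanishing second component.\<close>

definition clifford1 :: "complex ^ 2 ^ 2" where
  "clifford1 = vector [vector [0, -1], vector [1, 0]]"

definition clifford2 :: "complex ^ 2 ^ 2" where
  "clifford2 = vector [vector [0, \<i>], vector [\<i>, 0]]"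

definition S_plus :: "(complex ^ 2) set" where
  "S_plus = {v. \<i> *s (clifford1 *v (clifford2 *v v)) = v}"

text \<open>A global orthonormal frame \<open>e1, e2\<close> trivialises the spinor bundle of the spin structure to
  which the frame lifts. In this trivialisation the spinor connection is
  \<open>\<nabla>\<^bsub>X\<^esub> \<psi> = X(\<psi>) + 1/2 g(\<nabla>\<^bsub>X\<^esub> e1, e2) e1 \<cdot> e2 \<cdot> \<psi>\<close>.\<close>

definition spinor_connection ::
  "metric \<Rightarrow> vfield \<Rightarrow> vfield \<Rightarrow> vfield \<Rightarrow> spinor_field \<Rightarrow> spinor_field" where
  "spinor_connection g e1 e2 X \<psi> p =
    dir_deriv (X p) \<psi> p
    + (levi_civita g X e1 e2 p / 2) *\<^sub>R (clifford1 *v (clifford2 *v \<psi> p))"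

definition dirac_operator ::
  "metric \<Rightarrow> vfield \<Rightarrow> vfield \<Rightarrow> spinor_field \<Rightarrow> spinor_field" where
  "dirac_operator g e1 e2 \<psi> p =
    clifford1 *v spinor_connection g e1 e2 e1 \<psi> p
    + clifford2 *v spinor_connection g e1 e2 e2 \<psi> p"

text \<open>The metric \<open>g = h(t)^4 (dt\<^sup>2 + dy\<^sup>2)\<close> and its orthonormal frame
  \<open>h\<^sup>-\<^sup>2 \<partial>\<^sub>t, h\<^sup>-\<^sup>2 \<partial>\<^sub>y\<close>. The trivial spin structure is the one to which this frame lifts, so its
  spinor fields are the functions that are 1-periodic in both variables.\<close>

definition torus_metric :: "(real \<Rightarrow> real) \<Rightarrow> metric" where
  "torus_metric h p u v = h (fst p) ^ 4 * (fst u * fst v + snd u * snd v)"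

definition frame_t :: "(real \<Rightarrow> real) \<Rightarrow> vfield" where
  "frame_t h p = (1 / (h (fst p))\<^sup>2, 0)"

definition frame_y :: "(real \<Rightarrow> real) \<Rightarrow> vfield" where
  "frame_y h p = (0, 1 / (h (fst p))\<^sup>2)"

definition torus_dirac :: "(real \<Rightarrow> real) \<Rightarrow> spinor_field \<Rightarrow> spinor_field" where
  "torus_dirac h = dirac_operator (torus_metric h) (frame_t h) (frame_y h)"

definition torus_spinors :: "spinor_field set" where
  "torus_spinors =
    {\<psi>. smooth \<psi> \<and> (\<forall>t y. \<psi> (t + 1, y) = \<psi> (t, y)) \<and> (\<forall>t y. \<psi> (t, y + 1) = \<psi> (t, y))}"

text \<open>The eigenspace \<open>E(\<mu>)\<close> of the square of the Dirac operator in the sections of \<open>S\<^sup>+\<close>.\<close>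

definition eigenspace :: "(real \<Rightarrow> real) \<Rightarrow> real \<Rightarrow> spinor_field set" where
  "eigenspace h \<mu> =
    {\<psi> \<in> torus_spinors. (\<forall>p. \<psi> p \<in> S_plus) \<and>
      (\<forall>p. torus_dirac h (torus_dirac h \<psi>) p = \<mu> *\<^sub>R \<psi> p)}"

text \<open>\<open>S\<^sup>1\<close> acts by translation in \<open>y\<close>; the frame is invariant, so the action on spinor fields is
  translation of the components. Weight \<open>l\<close> is normalised so that \<open>A(t) exp(2 \<pi> \<i> l y)\<close> has
  weight \<open>l\<close>.\<close>

definition contains_weight :: "spinor_field set \<Rightarrow> int \<Rightarrow> bool" where
  "contains_weight E l \<longleftrightarrow>
    (\<exists>\<psi>\<in>E. (\<exists>p. \<psi> p \<noteq> 0) \<and>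
      (\<forall>s t y. \<psi> (t, y + s) = exp (2 * of_real pi * \<i> * of_int l * of_real s) *s \<psi> (t, y)))"

definition first_eigenvalue :: "(real \<Rightarrow> real) \<Rightarrow> int \<Rightarrow> real" where
  "first_eigenvalue h l = (LEAST \<mu>. contains_weight (eigenspace h \<mu>) l)"

end

theory Submission
  imports Defs "HOL-Complex_Analysis.Great_Picard"
begin

text \<open>Put \<open>c = 2 \<pi> l\<close> and \<open>w = h\<^sup>2\<close>. On spinors of weight \<open>l\<close> the Dirac operator is a first-order
  ordinary differential operator in \<open>t\<close>; after multiplication by \<open>h\<close> the eigenvalue problem for
  \<open>D\<^sup>2\<close> on \<open>S\<^sup>+\<close> becomes the periodic first-order system \<open>a' - c a = w b\<close>,
  \<open>b' + c b = - \<mu> w a\<close>, whose Rayleigh quotient is the right-hand side of the inequality. So one has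
  to show that the infimum of the quotient is attained. For \<open>c = 0\<close> it is 0, attained by constants.
  For \<open>c \<noteq> 0\<close> both equations can be solved uniquely, the solution operator \<open>f \<mapsto> a\<close> of
  \<open>b' + c b = - w f\<close>, \<open>a' - c a = w b\<close> is symmetric and positive for the weight \<open>w\<close> and maps
  \<open>L\<^sup>2\<close>-bounded sets to equicontinuous ones, and by the Arzela-Ascoli theorem its largest
  eigenvalue \<open>1 / \<mu>\<close> is attained.\<close>

section \<open>Smooth functions and the Dirac operator on Fourier modes\<close>

text \<open>The recursion carries the derivative as a witness, so each closure rule reduces to
  exhibiting a derivative built from functions already handled at order \<open>k\<close>.\<close>

primrec times_differentiable :: "nat \<Rightarrow> (real \<Rightarrow> 'b::real_normed_vector) \<Rightarrow> bool" where
  "times_differentiable 0 f \<longleftrightarrow> True"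
| "times_differentiable (Suc k) f \<longleftrightarrow>
    (\<exists>f'. (\<forall>t. (f has_vector_derivative f' t) (at t)) \<and> times_differentiable k f')"

lemma times_differentiable_SucI:
  "(\<And>t. (f has_vector_derivative f' t) (at t)) \<Longrightarrow> times_differentiable k f' \<Longrightarrow>
    times_differentiable (Suc k) f"
  by auto

lemma times_differentiable_SucD: "times_differentiable (Suc k) f \<Longrightarrow> times_differentiable k f"
proof (induction k arbitrary: f)
  case (Suc k)
  then show ?case by (metis times_differentiable.simps(2))
qed simp

lemma times_differentiable_const: "times_differentiable k (\<lambda>_. x)"
proof (induction k arbitrary: x)
  case (Suc k)
  then show ?case
    unfolding times_differentiable.simps by (intro exI[of _ "\<lambda>_. 0"]) simp
qed simp

lemma times_differentiable_linear:
  assumes "bounded_linear L" "times_differentiable k f"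
  shows "times_differentiable k (\<lambda>t. L (f t))"
  using assms(2)
proof (induction k arbitrary: f)
  case (Suc k)
  then obtain f' where f': "\<And>t. (f has_vector_derivative f' t) (at t)" "times_differentiable k f'"
    by auto
  then show ?case
    using Suc.IH[OF f'(2)] bounded_linear.has_vector_derivative[OF assms(1) f'(1)]
    by (auto intro!: exI[of _ "\<lambda>t. L (f' t)"])
qed simp

lemma times_differentiable_add:
  assumes "times_differentiable k f" "times_differentiable k g"
  shows "times_differentiable k (\<lambda>t. f t + g t)"
  using assms
proof (induction k arbitrary: f g)
  case (Suc k)
  then obtain f' g' where *: "\<And>t. (f has_vector_derivative f' t) (at t)" "times_differentiable k f'"
    "\<And>t. (g has_vector_derivative g' t) (at t)" "times_differentiable k g'"
    by auto
  show ?case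
    by (rule times_differentiable_SucI[OF has_vector_derivative_add[OF *(1,3)] Suc.IH[OF *(2,4)]])
qed simp

lemma times_differentiable_mult:
  fixes f g :: "real \<Rightarrow> 'b::real_normed_algebra"
  assumes "times_differentiable k f" "times_differentiable k g"
  shows "times_differentiable k (\<lambda>t. f t * g t)"
  using assms
proof (induction k arbitrary: f g)
  case (Suc k)
  then obtain f' g' where *: "\<And>t. (f has_vector_derivative f' t) (at t)" "times_differentiable k f'"
    "\<And>t. (g has_vector_derivative g' t) (at t)" "times_differentiable k g'"
    by auto
  have "times_differentiable k (\<lambda>t. f t * g' t + f' t * g t)"
    using * Suc times_differentiable_SucD by (intro times_differentiable_add Suc.IH) blast+
  then show ?case
    by (rule times_differentiable_SucI[OF has_vector_derivative_mult[OF *(1,3)]])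
qed simp

text \<open>The derivative of 1/h is the negative product of h' with two copies of 1/h; these copies
  have order \<open>k\<close> by the induction hypothesis.\<close>

lemma times_differentiable_inverse:
  fixes h :: "real \<Rightarrow> real"
  assumes "times_differentiable k h" "\<And>t. h t \<noteq> 0"
  shows "times_differentiable k (\<lambda>t. inverse (h t))"
  using assms(1)
proof (induction k)
  case (Suc k)
  then obtain h' where h': "\<And>t. (h has_vector_derivative h' t) (at t)" "times_differentiable k h'"
    by auto
  have inv: "times_differentiable k (\<lambda>t. inverse (h t))"
    using Suc times_differentiable_SucD by blast
  have "times_differentiable k (\<lambda>t. - 1 * (inverse (h t) * h' t * inverse (h t)))"
    by (intro times_differentiable_mult times_differentiable_const inv h')
  then show ?case
  proof (rule times_differentiable_SucI[rotated])
    show "((\<lambda>t. inverse (h t)) has_vector_derivative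
      - 1 * (inverse (h t) * h' t * inverse (h t))) (at t)" for t
      using DERIV_inverse'[of h "h' t" t UNIV] h'(1)[of t] assms(2)
      by (simp add: has_real_derivative_iff_has_vector_derivative)
  qed
qed simp

text \<open>Each order provides its own witness; uniqueness of derivatives identifies them
  all.\<close>

lemma all_times_differentiable_derivative:
  assumes "\<And>k. times_differentiable k f"
  shows "\<exists>f'. (\<forall>t. (f has_vector_derivative f' t) (at t)) \<and> (\<forall>k. times_differentiable k f')"
proof -
  have "\<exists>f'. (\<forall>t. (f has_vector_derivative f' t) (at t)) \<and> times_differentiable k f'" for k
    using assms[of "Suc k"] by simp
  then obtain f' where f': "\<And>k t. (f has_vector_derivative f' k t) (at t)"
    "\<And>k. times_differentiable k (f' k)"
    by metis
  have "f' k = f' 0" for k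
    using vector_derivative_unique_at[OF f'(1) f'(1)] by blast
  then show ?thesis using f' by metis
qed

lemma smooth_dir_deriv: "smooth f \<Longrightarrow> smooth (dir_deriv v f)"
  unfolding smooth_def
proof (intro allI)
  fix vs x
  assume "\<forall>vs x. foldr dir_deriv vs f differentiable at x"
  \<comment> \<open>\<open>foldr\<close> applies the last entry of the list first, so
    differentiating along \<open>v\<close> beforehand amounts to appending \<open>v\<close> at the
    end.\<close>
  then have "foldr dir_deriv (vs @ [v]) f differentiable at x" by blast
  then show "foldr dir_deriv vs (dir_deriv v f) differentiable at x" by simp
qed

lemma smooth_has_derivative: "smooth f \<Longrightarrow> (f has_derivative (\<lambda>v. dir_deriv v f x)) (at x)"
  unfolding smooth_def dir_deriv_def
  by (drule spec[of _ "[]"]) (simp add: frechet_derivative_works[symmetric])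

text \<open>The derivative along the line is \<open>dir_deriv v f\<close>, which is again smooth, so
  the induction runs over all \<open>f\<close>. It serves functions of one variable
  (\<open>v = 1\<close>) and the slice y = 0 of a spinor field (\<open>v = (1, 0)\<close>).\<close>

lemma smooth_along_line:
  assumes "smooth f"
  shows "times_differentiable k (\<lambda>t. f (p + t *\<^sub>R v))"
  using assms
proof (induction k arbitrary: f)
  case (Suc k)
  have "((\<lambda>t. f (p + t *\<^sub>R v)) has_vector_derivative dir_deriv v f (p + t *\<^sub>R v)) (at t)" for t
  proof -
    have "((\<lambda>t. p + t *\<^sub>R v) has_derivative (\<lambda>d. d *\<^sub>R v)) (at t)"
      by (auto intro!: derivative_eq_intros)
    from has_derivative_compose[OF this smooth_has_derivative[OF Suc.prems]]
    have "((\<lambda>t. f (p + t *\<^sub>R v)) has_derivative (\<lambda>d. dir_deriv (d *\<^sub>R v) f (p + t *\<^sub>R v))) (at t)" .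
    moreover have "dir_deriv (d *\<^sub>R v) f x = d *\<^sub>R dir_deriv v f x" for d x
      using smooth_has_derivative[OF Suc.prems, of x]
      by (intro linear_cmul has_derivative_linear)
    ultimately show ?thesis by (simp add: has_vector_derivative_def)
  qed
  then show ?case
    by (rule times_differentiable_SucI) (intro Suc.IH smooth_dir_deriv Suc.prems)
qed simp

lemma smooth_times_differentiable:
  fixes f :: "real \<Rightarrow> 'b::real_normed_vector"
  shows "smooth f \<Longrightarrow> times_differentiable k f"
  using smooth_along_line[of f k 0 1] by simp

section \<open>Spinor fields with a single Fourier mode in y\<close>

text \<open>On the torus the frequency \<open>c\<close> will be 2 pi l. Component 1 is the half S^+
  by \<open>mem_S_plus_iff\<close>, component 2 the half S^-.\<close>

definition mode :: "real \<Rightarrow> 2 \<Rightarrow> (real \<Rightarrow> complex) \<Rightarrow> spinor_field" where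
  "mode c j F p = axis j (cis (c * snd p) * F (fst p))"

lemma bounded_linear_axis: "bounded_linear (axis j :: complex \<Rightarrow> complex ^ 2)"
  unfolding linear_conv_bounded_linear[symmetric]
  by (rule linearI) (auto simp: vec_eq_iff axis_def)

lemma mode_has_derivative:
  assumes "(F has_vector_derivative F') (at t)"
  shows "(mode c j F has_derivative
    (\<lambda>v. axis j (cis (c * y) * (fst v *\<^sub>R F' + (\<i> * of_real (c * snd v)) * F t)))) (at (t, y))"
proof -
  \<comment> \<open>The exponential is differentiated as a holomorphic function and then restricted
    to the real axis.\<close>
  have "((\<lambda>z. exp (\<i> * of_real c * z)) has_field_derivative
      \<i> * of_real c * exp (\<i> * of_real c * of_real y)) (at (of_real y))"
    by (auto intro!: derivative_eq_intros)
  from has_vector_derivative_real_field[OF this]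
  have "((\<lambda>y. cis (c * y)) has_vector_derivative \<i> * of_real c * cis (c * y)) (at y)"
    by (simp add: cis_conv_exp mult.assoc)
  then have "((\<lambda>y. cis (c * y)) has_derivative (\<lambda>d. d *\<^sub>R (\<i> * of_real c * cis (c * y)))) (at (snd (t, y)))"
    by (simp add: has_vector_derivative_def)
  from has_derivative_compose[OF has_derivative_snd[OF has_derivative_ident] this]
  have 1: "((\<lambda>p. cis (c * snd p)) has_derivative
      (\<lambda>v. snd v *\<^sub>R (\<i> * of_real c * cis (c * y)))) (at (t, y))" .
  have "(F has_derivative (\<lambda>d. d *\<^sub>R F')) (at (fst (t, y)))"
    using assms by (simp add: has_vector_derivative_def)
  from has_derivative_compose[OF has_derivative_fst[OF has_derivative_ident] this]
  have 2: "((\<lambda>p. F (fst p)) has_derivative (\<lambda>v. fst v *\<^sub>R F')) (at (t, y))" .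
  from bounded_linear.has_derivative[OF bounded_linear_axis has_derivative_mult[OF 1 2], of j]
  show ?thesis
    by (simp add: mode_def[abs_def] scaleR_conv_of_real algebra_simps)
qed

lemma dir_deriv_mode:
  assumes "(F has_vector_derivative F') (at t)"
  shows "dir_deriv v (mode c j F) (t, y) =
    axis j (cis (c * y) * (fst v *\<^sub>R F' + (\<i> * of_real (c * snd v)) * F t))"
  unfolding dir_deriv_def frechet_derivative_at[OF mode_has_derivative[OF assms], symmetric] ..

text \<open>Modes of fixed frequency and component are closed under directional derivatives: only
  the profile changes, from F to v_1 F' + i c v_2 F. Smoothness thus reduces to the profile in
  t.\<close>

lemma smooth_mode:
  assumes "\<And>k. times_differentiable k F"
  shows "smooth (mode c j F)"
proof -
  have "\<exists>G. (\<forall>k. times_differentiable k G) \<and> foldr dir_deriv vs (mode c j F) = mode c j G" for vs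
  proof (induction vs)
    case Nil
    then show ?case using assms by auto
  next
    case (Cons v vs)
    then obtain G where G: "\<And>k. times_differentiable k G"
      "foldr dir_deriv vs (mode c j F) = mode c j G"
      by blast
    obtain G' where G': "\<And>t. (G has_vector_derivative G' t) (at t)" "\<And>k. times_differentiable k G'"
      using all_times_differentiable_derivative[OF G(1)] by blast
    define H where "H = (\<lambda>t. of_real (fst v) * G' t + (\<i> * of_real (c * snd v)) * G t)"
    have "dir_deriv v (mode c j G) = mode c j H"
      by (rule ext, case_tac x)
        (simp add: dir_deriv_mode[OF G'(1)] mode_def H_def scaleR_conv_of_real)
    moreover have "times_differentiable k H" for k
      unfolding H_def
      by (intro times_differentiable_add times_differentiable_mult times_differentiable_const G G')
    ultimately show ?case using G(2) by auto
  qed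
  moreover have "mode c j G differentiable at p" if "\<And>k. times_differentiable k G" for G p
    using all_times_differentiable_derivative[OF that] mode_has_derivative
    by (cases p) (auto simp: differentiable_def, blast)
  ultimately show ?thesis
    unfolding smooth_def by metis
qed

section \<open>Clifford action, connection and Dirac operator in the invariant frame\<close>

lemma clifford1_mult: "clifford1 *v v = vector [- v $ 2, v $ 1]"
  by (simp add: clifford1_def vec_eq_iff forall_2 matrix_vector_mult_def sum_2 vector_2)

lemma clifford2_mult: "clifford2 *v v = vector [\<i> * v $ 2, \<i> * v $ 1]"
  by (simp add: clifford2_def vec_eq_iff forall_2 matrix_vector_mult_def sum_2 vector_2)

text \<open>The matrix i \<open>clifford1\<close> \<open>clifford2\<close> is diag(1, -1).\<close>

lemma mem_S_plus_iff: "v \<in> S_plus \<longleftrightarrow> v $ 2 = 0"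
  by (simp add: S_plus_def clifford1_mult clifford2_mult vec_eq_iff forall_2 vector_2
      vector_scalar_mult_def flip: mult.assoc)

lemma dir_deriv_const: "dir_deriv v (\<lambda>_. k) p = 0"
  by (simp add: dir_deriv_def)

context
  fixes h h' :: "real \<Rightarrow> real"
  assumes pos: "\<And>t. h t > 0" and der: "\<And>t. (h has_real_derivative h' t) (at t)"
begin

lemma inverse_square_has_derivative:
  "((\<lambda>p. 1 / (h (fst p))\<^sup>2) has_derivative (\<lambda>v. - 2 * h' (fst p) / h (fst p) ^ 3 * fst v))
    (at (p :: real \<times> real))"
proof -
  have "((\<lambda>t. 1 / (h t)\<^sup>2) has_real_derivative - 2 * h' t / h t ^ 3) (at t)" for t
    using pos[of t] by (auto intro!: derivative_eq_intros der
      simp: power2_eq_square power3_eq_cube divide_simps)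
  then have "((\<lambda>t. 1 / (h t)\<^sup>2) has_derivative (*) (- 2 * h' (fst p) / h (fst p) ^ 3)) (at (fst p))"
    by (simp add: has_field_derivative_def)
  from has_derivative_compose[OF has_derivative_fst[OF has_derivative_ident] this]
  show ?thesis .
qed

lemma dir_deriv_frame_t:
  "dir_deriv v (frame_t h) p = (- 2 * h' (fst p) / h (fst p) ^ 3 * fst v, 0)"
proof -
  have "(frame_t h has_derivative (\<lambda>v. (- 2 * h' (fst p) / h (fst p) ^ 3 * fst v, 0))) (at p)"
    unfolding frame_t_def[abs_def]
    by (intro has_derivative_Pair inverse_square_has_derivative has_derivative_const)
  then show ?thesis
    by (simp add: dir_deriv_def frechet_derivative_at[symmetric])
qed

lemma dir_deriv_frame_y:
  "dir_deriv v (frame_y h) p = (0, - 2 * h' (fst p) / h (fst p) ^ 3 * fst v)"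
proof -
  have "(frame_y h has_derivative (\<lambda>v. (0, - 2 * h' (fst p) / h (fst p) ^ 3 * fst v))) (at p)"
    unfolding frame_y_def[abs_def]
    by (intro has_derivative_Pair inverse_square_has_derivative has_derivative_const)
  then show ?thesis
    by (simp add: dir_deriv_def frechet_derivative_at[symmetric])
qed

text \<open>These are equalities of functions, so that the three derivative terms of the Koszul
  formula become derivatives of constants and vanish.\<close>

lemma torus_metric_frame:
  "(\<lambda>q. torus_metric h q (frame_t h q) (frame_t h q)) = (\<lambda>_. 1)"
  "(\<lambda>q. torus_metric h q (frame_y h q) (frame_y h q)) = (\<lambda>_. 1)"
  "(\<lambda>q. torus_metric h q (frame_t h q) (frame_y h q)) = (\<lambda>_. 0)"
  "(\<lambda>q. torus_metric h q (frame_y h q) (frame_t h q)) = (\<lambda>_. 0)"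
  using pos by (auto simp: torus_metric_def frame_t_def frame_y_def fun_eq_iff less_imp_neq[symmetric]
      power2_eq_square power4_eq_xxxx)

text \<open>Only the bracket terms of the Koszul formula survive, and they all come from [e_t, e_y]
  = -2 h'/h^3 e_y.\<close>

lemma levi_civita_frame:
  "levi_civita (torus_metric h) (frame_t h) (frame_t h) (frame_y h) p = 0"
  "levi_civita (torus_metric h) (frame_y h) (frame_t h) (frame_y h) p = 2 * h' (fst p) / h (fst p) ^ 3"
  using pos[of "fst p"]
  unfolding levi_civita_def torus_metric_frame dir_deriv_const lie_bracket_def
    dir_deriv_frame_t dir_deriv_frame_y
  by (simp_all add: torus_metric_def frame_t_def frame_y_def)
    (simp add: divide_simps eval_nat_numeral)

text \<open>Clifford multiplication exchanges the two halves. The term h'/h is the spin connection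
  along \<open>frame_y\<close>, and -c is i (from \<open>clifford2\<close>) times i c (from d/dy).
  On component 2, treated next, the signs of F' and h'/h flip while that of c stays, which produces
  the adjoint pair d/dt - c and -(d/dt + c).\<close>

lemma torus_dirac_mode_1:
  assumes "\<And>t. (F has_vector_derivative F' t) (at t)"
  shows "torus_dirac h (mode c 1 F) =
    mode c 2 (\<lambda>t. (1 / (h t)\<^sup>2) *\<^sub>R (F' t + (h' t / h t - c) *\<^sub>R F t))"
proof
  fix p :: point
  obtain t y where p: "p = (t, y)" by (cases p)
  show "torus_dirac h (mode c 1 F) p =
      mode c 2 (\<lambda>t. (1 / (h t)\<^sup>2) *\<^sub>R (F' t + (h' t / h t - c) *\<^sub>R F t)) p"
    unfolding torus_dirac_def dirac_operator_def spinor_connection_def levi_civita_frame p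
      dir_deriv_mode[OF assms]
    using pos[of t]
    by (simp add: clifford1_mult clifford2_mult mode_def frame_t_def frame_y_def vec_eq_iff
        forall_2 vector_2 axis_def)
      (simp add: scaleR_conv_of_real divide_simps power2_eq_square power3_eq_cube algebra_simps)
qed

lemma torus_dirac_mode_2:
  assumes "\<And>t. (F has_vector_derivative F' t) (at t)"
  shows "torus_dirac h (mode c 2 F) =
    mode c 1 (\<lambda>t. - (1 / (h t)\<^sup>2) *\<^sub>R (F' t + (h' t / h t + c) *\<^sub>R F t))"
proof
  fix p :: point
  obtain t y where p: "p = (t, y)" by (cases p)
  show "torus_dirac h (mode c 2 F) p =
      mode c 1 (\<lambda>t. - (1 / (h t)\<^sup>2) *\<^sub>R (F' t + (h' t / h t + c) *\<^sub>R F t)) p"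
    unfolding torus_dirac_def dirac_operator_def spinor_connection_def levi_civita_frame p
      dir_deriv_mode[OF assms]
    using pos[of t]
    by (simp add: clifford1_mult clifford2_mult mode_def frame_t_def frame_y_def vec_eq_iff
        forall_2 vector_2 axis_def)
      (simp add: scaleR_conv_of_real divide_simps power2_eq_square power3_eq_cube algebra_simps)
qed

end

section \<open>Periodic solutions of first-order linear equations\<close>

text \<open>This is the space on which the spectral argument runs. It is not complete for the
  weighted L2 norm; limits are taken uniformly instead.\<close>

definition periodic_continuous :: "(real \<Rightarrow> real) set" where
  "periodic_continuous = {f. continuous_on UNIV f \<and> (\<forall>t. f (t + 1) = f t)}"

text \<open>The first argument belongs to d/dt + c, so the adjoint operator d/dt - c is written with
  \<open>- c\<close>.\<close>

definition periodic_solution :: "real \<Rightarrow> (real \<Rightarrow> real) \<Rightarrow> (real \<Rightarrow> real) \<Rightarrow> bool" where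
  "periodic_solution c g b \<longleftrightarrow>
    (\<forall>t. (b has_real_derivative g t - c * b t) (at t)) \<and> (\<forall>t. b (t + 1) = b t)"

text \<open>The antiderivative is the signed integral from 0. Near a given point it differs by a
  constant from an integral with a fixed left end, to which the fundamental theorem of calculus
  applies.\<close>

lemma continuous_imp_antiderivative:
  fixes g :: "real \<Rightarrow> real"
  assumes "continuous_on UNIV g"
  shows "\<exists>F. \<forall>t. (F has_real_derivative g t) (at t)"
proof (intro exI allI)
  fix x :: real
  define F where "F = (\<lambda>t. integral {0..t} g - integral {t..0} g)"
  \<comment> \<open>This places \<open>x\<close> in the interior of \<open>{-N..N}\<close>, so a
    derivative within the interval is a full derivative.\<close>
  define N where "N = \<bar>x\<bar> + 1"
  have cont: "continuous_on S g" for S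
    using assms continuous_on_subset by blast
  have int: "g integrable_on {a..b}" for a b
    by (simp add: integrable_continuous_real cont)
  have F_eq: "F y = integral {-N..y} g - integral {-N..0} g" if "y \<in> {-N<..<N}" for y
  proof (cases "0 \<le> y")
    case True
    then have "integral {-N..0} g + integral {0..y} g = integral {-N..y} g"
      using int by (intro Henstock_Kurzweil_Integration.integral_combine) (auto simp: N_def)
    moreover have "integral {y..0} g = 0"
      using True by (cases "y = 0") auto
    ultimately show ?thesis by (simp add: F_def)
  next
    case False
    then have "integral {-N..y} g + integral {y..0} g = integral {-N..0} g"
      using int that by (intro Henstock_Kurzweil_Integration.integral_combine) auto
    then show ?thesis using False by (simp add: F_def)
  qed
  have "((\<lambda>y. integral {-N..y} g) has_real_derivative g x) (at x within {-N..N})"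
    by (rule integral_has_real_derivative) (auto simp: cont N_def)
  then have "((\<lambda>y. integral {-N..y} g) has_real_derivative g x) (at x)"
    by (subst (asm) at_within_interior) (auto simp: N_def)
  then have "((\<lambda>y. integral {-N..y} g - integral {-N..0} g) has_real_derivative g x) (at x)"
    by (auto intro!: derivative_eq_intros)
  then show "(F has_real_derivative g x) (at x)"
    by (rule has_field_derivative_transform_within_open[where S = "{-N<..<N}"])
      (auto simp: N_def F_eq)
qed

lemma DERIV_all_zero_constant:
  fixes f :: "real \<Rightarrow> real"
  assumes "\<And>t. (f has_real_derivative 0) (at t)"
  shows "f s = f t"
  using DERIV_isconst_all assms by blast

text \<open>exp(ct) is the integrating factor of d/dt + c.\<close>

lemma exp_shift_derivative:
  assumes "(b has_real_derivative g - c * b t) (at t)"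
  shows "((\<lambda>t. exp (c * t) * b t) has_real_derivative exp (c * t) * g) (at t)"
  by (rule derivative_eq_intros assms refl)+ (simp add: algebra_simps)

text \<open>Variation of constants gives a one-parameter family of solutions. Since exp c differs
  from 1, exactly one of them takes equal values at 0 and 1.\<close>

lemma periodic_solution_exists:
  assumes "c \<noteq> 0" "g \<in> periodic_continuous"
  shows "\<exists>b. periodic_solution c g b"
proof -
  have cont: "continuous_on UNIV g" and per: "\<And>t. g (t + 1) = g t"
    using assms(2) by (auto simp: periodic_continuous_def)
  have "continuous_on UNIV (\<lambda>t. exp (c * t) * g t)"
    by (intro continuous_intros cont)
  from continuous_imp_antiderivative[OF this]
  obtain F where F: "\<And>t. (F has_real_derivative exp (c * t) * g t) (at t)"
    by blast
  \<comment> \<open>\<open>C\<close> solves b(1) = b(0), that is exp(-c) (F(1) - C) = F(0) -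
    C.\<close>
  define C where "C = (F 1 - exp c * F 0) / (1 - exp c)"
  have ec: "1 - exp c \<noteq> 0" using assms(1) by simp
  define b where "b = (\<lambda>t. exp (- (c * t)) * (F t - C))"
  have C: "F 1 - C = exp c * (F 0 - C)"
    using ec by (simp add: C_def divide_simps) (simp add: algebra_simps)
  have b: "(b has_real_derivative g t - c * b t) (at t)" for t
  proof -
    have "(b has_real_derivative
        - c * exp (- (c * t)) * (F t - C) + exp (- (c * t)) * (exp (c * t) * g t)) (at t)"
      unfolding b_def by (rule derivative_eq_intros F refl)+ simp
    moreover have "exp (- (c * t)) * (exp (c * t) * g t) = g t"
      by (simp flip: mult.assoc exp_add)
    ultimately show ?thesis by (simp add: b_def mult.assoc)
  qed
  \<comment> \<open>The defect of periodicity solves the homogeneous equation and vanishes at 0,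
    hence everywhere.\<close>
  define d where "d = (\<lambda>t. b (t + 1) - b t)"
  have "(d has_real_derivative 0 - c * d t) (at t)" for t
  proof -
    have "((\<lambda>t. b (t + 1)) has_real_derivative g t - c * b (t + 1)) (at t)"
      using b[of "t + 1"] by (simp add: DERIV_shift per)
    from DERIV_diff[OF this b] show ?thesis
      by (simp add: d_def algebra_simps)
  qed
  then have "((\<lambda>t. exp (c * t) * d t) has_real_derivative 0) (at t)" for t
    using exp_shift_derivative by fastforce
  then have "exp (c * t) * d t = exp (c * 0) * d 0" for t
    by (rule DERIV_all_zero_constant)
  moreover have "d 0 = 0"
    using C by (simp add: d_def b_def exp_minus)
  ultimately have "b (t + 1) = b t" for t
    by (simp add: d_def)
  with b show ?thesis by (auto simp: periodic_solution_def)
qed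

lemma periodic_solution_lincomb:
  assumes "periodic_solution c g a" "periodic_solution c h b"
  shows "periodic_solution c (\<lambda>t. x * g t + y * h t) (\<lambda>t. x * a t + y * b t)"
proof -
  have "((\<lambda>t. x * a t + y * b t) has_real_derivative x * (g t - c * a t) + y * (h t - c * b t)) (at t)"
    for t
    using assms unfolding periodic_solution_def by (intro DERIV_add DERIV_cmult) auto
  moreover have "x * (g t - c * a t) + y * (h t - c * b t) =
      x * g t + y * h t - c * (x * a t + y * b t)" for t
    by (simp add: algebra_simps)
  ultimately show ?thesis
    using assms unfolding periodic_solution_def by simp
qed

lemma periodic_solution_continuous:
  assumes "periodic_solution c g b"
  shows "b \<in> periodic_continuous"
  using assms DERIV_continuous_on[of UNIV b "\<lambda>t. g t - c * b t"]
  unfolding periodic_solution_def periodic_continuous_def by simp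

lemma periodic_reduce:
  fixes f :: "real \<Rightarrow> 'a"
  assumes "\<And>t. f (t + 1) = f t"
  shows "f (frac t) = f t"
proof -
  have "f (t + of_int k) = f t" for t and k :: int
  proof (induction k rule: int_induct[where k = 0])
    case (step1 i)
    then show ?case using assms[of "t + of_int i"] by (simp add: add.assoc)
  next
    case (step2 i)
    then show ?case using assms[of "t + of_int (i - 1)"] by simp
  qed simp
  from this[of "frac t" "\<lfloor>t\<rfloor>"] show ?thesis by (simp add: frac_def)
qed

section \<open>Sup-norm estimate by the L1 size of the right-hand side, and uniqueness\<close>

text \<open>Inside the parentheses, the first term accounts for b(0) and the second for the integral
  from 0 to t; the outer factor undoes the integrating factor.\<close>

definition solution_bound :: "real \<Rightarrow> real" where
  "solution_bound c = exp \<bar>c\<bar> * (exp \<bar>c\<bar> / \<bar>exp c - 1\<bar> + exp \<bar>c\<bar>)"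

lemma solution_bound_pos: "c \<noteq> 0 \<Longrightarrow> solution_bound c > 0"
  by (simp add: solution_bound_def add_nonneg_pos)

text \<open>Integrating exp(ct) g over a full period determines b(0) up to the factor exp c - 1, and
  integrating up to s then controls b(s). The majorant \<open>G\<close> is later w |f|, or 0 for
  uniqueness.\<close>

lemma periodic_solution_bound:
  assumes "c \<noteq> 0" and g: "g \<in> periodic_continuous" and b: "periodic_solution c g b"
    and G: "\<And>t. \<bar>g t\<bar> \<le> G t" "G integrable_on {0..1}"
  shows "\<bar>b t\<bar> \<le> solution_bound c * integral {0..1} G"
proof -
  define M where "M = exp \<bar>c\<bar>"
  define J where "J = integral {0..1} G"
  have der: "\<And>t. (b has_real_derivative g t - c * b t) (at t)" and per: "\<And>t. b (t + 1) = b t"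
    using b by (auto simp: periodic_solution_def)
  have cont: "continuous_on S g" for S
    using g continuous_on_subset by (auto simp: periodic_continuous_def)
  have I: "\<bar>exp (c * s) * b s - b 0\<bar> \<le> M * J" if "s \<in> {0..1}" for s
  proof -
    have "((\<lambda>t. exp (c * t) * g t) has_integral exp (c * s) * b s - exp (c * 0) * b 0) {0..s}"
      using that exp_shift_derivative[OF der]
      by (intro fundamental_theorem_of_calculus)
        (auto simp flip: has_real_derivative_iff_has_vector_derivative
          intro: has_field_derivative_at_within)
    then have "exp (c * s) * b s - b 0 = integral {0..s} (\<lambda>t. exp (c * t) * g t)"
      by (simp add: integral_unique)
    also have "\<bar>\<dots>\<bar> \<le> integral {0..s} (\<lambda>t. M * G t)"
    proof (subst real_norm_def[symmetric], rule integral_norm_bound_integral)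
      show "(\<lambda>t. exp (c * t) * g t) integrable_on {0..s}"
        by (intro integrable_continuous_real continuous_intros cont)
      show "(\<lambda>t. M * G t) integrable_on {0..s}"
        using integrable_on_subinterval[OF G(2), of 0 s] that
        by (intro integrable_on_mult_right) auto
      fix u assume u: "u \<in> {0..s}"
      have "\<bar>c * u\<bar> \<le> \<bar>c\<bar> * 1"
        unfolding abs_mult using u that by (intro mult_left_mono) auto
      then have "exp (c * u) \<le> M" by (simp add: M_def)
      then show "norm (exp (c * u) * g u) \<le> M * G u"
        using G(1)[of u] mult_mono[of "exp (c * u)" M "\<bar>g u\<bar>" "G u"]
        by (simp add: abs_mult M_def)
    qed
    also have "\<dots> \<le> integral {0..1} (\<lambda>t. M * G t)"
    proof (rule integral_subset_le)
      show "(\<lambda>t. M * G t) integrable_on {0..s}" "(\<lambda>t. M * G t) integrable_on {0..1}"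
        using integrable_on_subinterval[OF G(2), of 0 s] that G(2)
        by (auto intro!: integrable_on_mult_right)
      have "0 \<le> M * G u" for u
        using order_trans[OF abs_ge_zero, of "g u" "G u"] G(1) by (simp add: M_def)
      then show "\<forall>u\<in>{0..1}. 0 \<le> M * G u" by simp
    qed (use that in auto)
    finally show ?thesis by (simp add: J_def)
  qed
  \<comment> \<open>Periodicity turns the estimate at s = 1 into one for b(0) alone.\<close>
  have "\<bar>(exp c - 1) * b 0\<bar> \<le> M * J"
    using I[of 1] per[of 0] by (simp add: left_diff_distrib)
  then have b0: "\<bar>b 0\<bar> \<le> M * J / \<bar>exp c - 1\<bar>"
    using assms(1) by (simp add: abs_mult pos_le_divide_eq mult.commute)
  have bnd: "\<bar>b s\<bar> \<le> M * (M / \<bar>exp c - 1\<bar> + M) * J" if s: "s \<in> {0..1}" for s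
  proof -
    have "\<bar>c * s\<bar> \<le> \<bar>c\<bar> * 1"
      unfolding abs_mult using s by (intro mult_left_mono) auto
    then have E: "exp (- (c * s)) \<le> M" by (simp add: M_def)
    have "\<bar>exp (c * s) * b s\<bar> \<le> (M / \<bar>exp c - 1\<bar> + M) * J"
      using I[OF s] b0 by (simp add: algebra_simps)
    moreover have "\<bar>b s\<bar> = exp (- (c * s)) * \<bar>exp (c * s) * b s\<bar>"
      by (simp add: abs_mult flip: mult.assoc exp_add)
    ultimately show ?thesis
      using E mult_mono[of "exp (- (c * s))" M "\<bar>exp (c * s) * b s\<bar>"] by (simp add: M_def mult.assoc)
  qed
  show ?thesis
    using bnd[of "frac t"] periodic_reduce[of b t] per frac_lt_1[of t] frac_ge_0[of t]
    by (simp add: M_def J_def solution_bound_def less_imp_le)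
qed

text \<open>The difference has right-hand side 0, so the sup-norm estimate makes it vanish.\<close>

lemma periodic_solution_unique:
  assumes "c \<noteq> 0" "periodic_solution c g a" "periodic_solution c g b"
  shows "a = b"
proof
  fix t
  have "periodic_solution c (\<lambda>_. 0) (\<lambda>t. a t - b t)"
    using periodic_solution_lincomb[OF assms(2,3), of 1 "-1"] by simp
  moreover have "(\<lambda>_. 0) \<in> periodic_continuous"
    by (simp add: periodic_continuous_def)
  ultimately have "\<bar>a t - b t\<bar> \<le> solution_bound c * integral {0..1} (\<lambda>_. 0)"
    using periodic_solution_bound[OF assms(1), where g = "\<lambda>_. 0" and b = "\<lambda>t. a t - b t"
      and G = "\<lambda>_. 0"] by (simp add: integrable_0)
  then show "a t = b t" by simp
qed

section \<open>The space of continuous 1-periodic functions\<close>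

lemma periodic_continuous_imp_continuous_on: "f \<in> periodic_continuous \<Longrightarrow> continuous_on S f"
  unfolding periodic_continuous_def using continuous_on_subset by blast

lemma periodic_continuous_mult: "f \<in> periodic_continuous \<Longrightarrow> g \<in> periodic_continuous \<Longrightarrow>
    (\<lambda>t. f t * g t) \<in> periodic_continuous"
  unfolding periodic_continuous_def by (auto intro: continuous_on_mult)

lemma periodic_continuous_lincomb: "f \<in> periodic_continuous \<Longrightarrow> g \<in> periodic_continuous \<Longrightarrow>
    (\<lambda>t. x * f t + y * g t) \<in> periodic_continuous"
  unfolding periodic_continuous_def by (auto intro!: continuous_intros)

lemma periodic_continuous_const: "(\<lambda>_. k) \<in> periodic_continuous"
  by (simp add: periodic_continuous_def)

lemma periodic_continuous_integrable: "f \<in> periodic_continuous \<Longrightarrow> f integrable_on {a..b}"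
  by (simp add: integrable_continuous_real periodic_continuous_imp_continuous_on)

lemma periodic_continuous_bounded:
  assumes "f \<in> periodic_continuous"
  shows "\<exists>M>0. \<forall>t. \<bar>f t\<bar> \<le> M"
proof -
  have "compact (f ` {0..1})"
    by (intro compact_continuous_image periodic_continuous_imp_continuous_on assms compact_Icc)
  then obtain M where M: "M > 0" "\<And>y. y \<in> f ` {0..1} \<Longrightarrow> \<bar>y\<bar> \<le> M"
    using compact_imp_bounded bounded_pos[of "f ` {0..1}"] by auto
  have "\<bar>f t\<bar> \<le> M" for t
  proof -
    have "f (frac t) = f t"
      using assms by (intro periodic_reduce) (simp add: periodic_continuous_def)
    moreover have "f (frac t) \<in> f ` {0..1}"
      using frac_lt_1[of t] frac_ge_0[of t] by (intro imageI) (simp add: less_imp_le)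
    ultimately show ?thesis using M(2) by metis
  qed
  with M(1) show ?thesis by blast
qed

section \<open>The weighted L2 inner product\<close>

locale positive_weight =
  fixes w :: "real \<Rightarrow> real"
  assumes w: "w \<in> periodic_continuous" and w_pos: "\<And>t. 0 < w t"
begin

definition inner_w :: "(real \<Rightarrow> real) \<Rightarrow> (real \<Rightarrow> real) \<Rightarrow> real" where
  "inner_w f g = integral {0..1} (\<lambda>t. w t * f t * g t)"

lemma periodic_continuous_w_mult: "f \<in> periodic_continuous \<Longrightarrow> (\<lambda>t. w t * f t) \<in> periodic_continuous"
  using periodic_continuous_mult w by blast

lemma periodic_continuous_minus_w_mult: "f \<in> periodic_continuous \<Longrightarrow> (\<lambda>t. - w t * f t) \<in> periodic_continuous"
  using periodic_continuous_lincomb[OF periodic_continuous_w_mult periodic_continuous_w_mult, of f f "-1" 0] by simp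

lemma inner_integrable: "f \<in> periodic_continuous \<Longrightarrow> g \<in> periodic_continuous \<Longrightarrow>
    (\<lambda>t. w t * f t * g t) integrable_on {0..1}"
  by (intro periodic_continuous_integrable periodic_continuous_mult w)

lemma inner_commute: "inner_w f g = inner_w g f"
  by (simp add: inner_w_def mult.commute mult.left_commute)

lemma inner_nonneg: "0 \<le> inner_w f f"
proof (cases "(\<lambda>t. w t * f t * f t) integrable_on {0..1}")
  case True
  then show ?thesis unfolding inner_w_def
    using less_imp_le[OF w_pos] by (intro integral_nonneg) (auto simp: mult.assoc)
\<comment> \<open>A function that is not integrable has integral 0 by convention.\<close>
qed (simp add: inner_w_def not_integrable_integral)

lemma inner_lincomb:
  assumes "f \<in> periodic_continuous" "g \<in> periodic_continuous" "k \<in> periodic_continuous"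
  shows "inner_w (\<lambda>t. x * f t + y * g t) k = x * inner_w f k + y * inner_w g k"
proof -
  have "(\<lambda>t. w t * (x * f t + y * g t) * k t) =
      (\<lambda>t. x * (w t * f t * k t) + y * (w t * g t * k t))"
    by (simp add: algebra_simps)
  moreover have "((\<lambda>t. x * (w t * f t * k t) + y * (w t * g t * k t)) has_integral
      x * inner_w f k + y * inner_w g k) {0..1}"
    unfolding inner_w_def using assms
    by (intro has_integral_add has_integral_mult_right integrable_integral inner_integrable)
  ultimately show ?thesis
    by (simp only: inner_w_def integral_unique)
qed

lemma inner_square_lincomb:
  assumes "f \<in> periodic_continuous" "g \<in> periodic_continuous"
  shows "inner_w (\<lambda>t. x * f t + y * g t) (\<lambda>t. x * f t + y * g t) =
    x\<^sup>2 * inner_w f f + 2 * x * y * inner_w f g + y\<^sup>2 * inner_w g g"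
proof -
  let ?k = "\<lambda>t. x * f t + y * g t"
  have "inner_w f ?k = x * inner_w f f + y * inner_w f g"
    "inner_w g ?k = x * inner_w f g + y * inner_w g g"
    by (simp_all only: inner_commute[of _ ?k] inner_lincomb[OF assms] assms inner_commute[of g f])
  then have "inner_w ?k ?k =
      x * (x * inner_w f f + y * inner_w f g) + y * (x * inner_w f g + y * inner_w g g)"
    by (simp only: inner_lincomb[OF assms periodic_continuous_lincomb[OF assms]])
  then show ?thesis
    by (simp add: power2_eq_square algebra_simps)
qed

lemma inner_Cauchy_Schwarz:
  assumes "f \<in> periodic_continuous" "g \<in> periodic_continuous"
  shows "(inner_w f g)\<^sup>2 \<le> inner_w f f * inner_w g g"
proof (cases "inner_w g g = 0")
  case True
  have "0 \<le> inner_w f f + 2 * y * inner_w f g" for y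
    using inner_square_lincomb[OF assms, of 1 y] inner_nonneg[of "\<lambda>t. 1 * f t + y * g t"] True
    by simp
  \<comment> \<open>If <g,g> = 0 but <f,g> is nonzero, this y turns the lower bound into 0 \<le>
    -<f,f> - 2, a contradiction.\<close>
  from this[of "- (inner_w f f + 1) / inner_w f g"] show ?thesis
    using inner_nonneg[of f] by (cases "inner_w f g = 0") (auto simp: True)
next
  case False
  let ?G = "inner_w g g" and ?P = "inner_w f g"
  \<comment> \<open>The right side is the squared norm of <g,g> f - <f,g> g, a multiple of the part
    of f orthogonal to g.\<close>
  have "0 \<le> ?G\<^sup>2 * inner_w f f + 2 * ?G * (- ?P) * ?P + (- ?P)\<^sup>2 * ?G"
    using inner_square_lincomb[OF assms, of ?G "- ?P"]
      inner_nonneg[of "\<lambda>t. ?G * f t + (- ?P) * g t"] by linarith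
  also have "\<dots> = ?G * (inner_w f f * ?G - ?P\<^sup>2)"
    by (simp add: power2_eq_square algebra_simps)
  finally show ?thesis
    using False inner_nonneg[of g] by (simp add: zero_le_mult_iff)
qed

text \<open>The operators \<open>d/dt + c\<close> and \<open>c - d/dt\<close> are formally adjoint.\<close>

lemma inner_periodic_solutions:
  assumes pc: "f \<in> periodic_continuous" "\<psi> \<in> periodic_continuous"
    and \<phi>: "periodic_solution (- c) (\<lambda>t. w t * \<psi> t) \<phi>"
    and b: "periodic_solution c (\<lambda>t. - w t * f t) b"
  shows "inner_w f \<phi> = inner_w b \<psi>"
proof -
  have pc': "\<phi> \<in> periodic_continuous" "b \<in> periodic_continuous"
    using \<phi> b periodic_solution_continuous by blast+
  \<comment> \<open>The terms with c cancel in the derivative of the product, whose integral over a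
    period is zero.\<close>
  have "((\<lambda>t. b t * \<phi> t) has_real_derivative w t * b t * \<psi> t - w t * f t * \<phi> t) (at t)" for t
  proof -
    have "(b has_real_derivative - w t * f t - c * b t) (at t)"
      "(\<phi> has_real_derivative w t * \<psi> t - (- c) * \<phi> t) (at t)"
      using b \<phi> by (auto simp: periodic_solution_def)
    from DERIV_mult[OF this] show ?thesis
      by (simp add: algebra_simps)
  qed
  then have "((\<lambda>t. w t * b t * \<psi> t - w t * f t * \<phi> t) has_integral b 1 * \<phi> 1 - b 0 * \<phi> 0) {0..1}"
    by (intro fundamental_theorem_of_calculus)
      (auto simp flip: has_real_derivative_iff_has_vector_derivative
        intro: has_field_derivative_at_within)
  moreover have "b 1 * \<phi> 1 - b 0 * \<phi> 0 = 0"
  proof -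
    have "\<phi> (0 + 1) = \<phi> 0" "b (0 + 1) = b 0"
      using pc' unfolding periodic_continuous_def by blast+
    then show ?thesis by simp
  qed
  moreover have "((\<lambda>t. w t * b t * \<psi> t - w t * f t * \<phi> t) has_integral
      inner_w b \<psi> - inner_w f \<phi>) {0..1}"
    unfolding inner_w_def using pc pc'
    by (intro has_integral_diff integrable_integral inner_integrable)
  ultimately have "inner_w b \<psi> - inner_w f \<phi> = 0"
    by (metis has_integral_unique)
  then show ?thesis by simp
qed

text \<open>A continuous nonnegative integrand with integral 0 vanishes on [0,1]; periodicity moves
  the point where f is nonzero into this interval.\<close>

lemma inner_pos:
  assumes f: "f \<in> periodic_continuous" and "f t \<noteq> 0"
  shows "0 < inner_w f f"
proof -
  have "f (frac t) = f t"
    using f by (intro periodic_reduce) (simp add: periodic_continuous_def)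
  then have "w (frac t) * f (frac t) * f (frac t) \<noteq> 0"
    using assms(2) w_pos[of "frac t"] by simp
  moreover have "frac t \<in> {0..1}"
    using frac_lt_1[of t] frac_ge_0[of t] by simp
  moreover have "0 \<le> w s * f s * f s" for s
    using less_imp_le[OF w_pos] by (simp add: mult.assoc)
  ultimately have "inner_w f f \<noteq> 0"
    unfolding inner_w_def using integral_eq_0_iff[of 0 1 "\<lambda>s. w s * f s * f s"] periodic_continuous_mult[OF periodic_continuous_mult[OF w f] f]
    by (auto simp: periodic_continuous_imp_continuous_on)
  then show ?thesis using inner_nonneg[of f] by simp
qed

definition mass :: real where "mass = inner_w (\<lambda>_. 1) (\<lambda>_. 1)"

lemma mass_pos: "mass > 0"
proof -
  obtain t0 where t0: "t0 \<in> {0..1}" "\<And>t. t \<in> {0..1} \<Longrightarrow> w t0 \<le> w t"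
    using continuous_attains_inf[of "{0..1::real}" w] periodic_continuous_imp_continuous_on[OF w] by auto
  have "integral {0..1::real} (\<lambda>_. w t0) \<le> integral {0..1} w"
    using t0 by (intro integral_le periodic_continuous_integrable w periodic_continuous_const) auto
  then show ?thesis using w_pos[of t0] by (simp add: mass_def inner_w_def)
qed

lemma inner_le_of_bound:
  assumes "f \<in> periodic_continuous" "\<And>t. \<bar>f t\<bar> \<le> M"
  shows "inner_w f f \<le> M\<^sup>2 * mass"
proof -
  have "inner_w f f \<le> integral {0..1} (\<lambda>t. M\<^sup>2 * w t)"
    unfolding inner_w_def
  proof (rule integral_le[OF inner_integrable[OF assms(1,1)]])
    show "(\<lambda>t. M\<^sup>2 * w t) integrable_on {0..1}"
      by (intro integrable_on_mult_right periodic_continuous_integrable w)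
    show "w t * f t * f t \<le> M\<^sup>2 * w t" for t
    proof -
      have "(f t)\<^sup>2 \<le> M\<^sup>2"
        using assms(2)[of t] power_mono[of "\<bar>f t\<bar>" M 2] by simp
      then show ?thesis
        using w_pos[of t] by (simp add: power2_eq_square mult.assoc mult.commute[of "w t"])
    qed
  qed
  then show ?thesis by (simp add: mass_def inner_w_def)
qed

text \<open>\<open>\<integral> w |f|\<close> is controlled by the weighted \<open>L\<^sup>2\<close> norm because \<open>w\<close> has finite mass.\<close>

lemma solution_bound_inner:
  assumes "k \<noteq> 0" "f \<in> periodic_continuous" "periodic_solution k g b"
    and "g = (\<lambda>t. w t * f t) \<or> g = (\<lambda>t. - w t * f t)"
  shows "(b t)\<^sup>2 \<le> (solution_bound k)\<^sup>2 * (mass * inner_w f f)"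
proof -
  let ?f = "\<lambda>t. \<bar>f t\<bar>"
  have pc: "?f \<in> periodic_continuous"
    using assms(2) by (auto simp: periodic_continuous_def intro: continuous_on_rabs)
  have "g \<in> periodic_continuous"
    using assms(4) periodic_continuous_w_mult periodic_continuous_minus_w_mult assms(2) by auto
  then have "\<bar>b t\<bar> \<le> solution_bound k * integral {0..1} (\<lambda>t. w t * \<bar>f t\<bar>)"
    using assms(4) w_pos
    by (intro periodic_solution_bound[OF assms(1) _ assms(3)] periodic_continuous_integrable periodic_continuous_w_mult pc)
      (auto simp: abs_mult less_imp_le)
  also have "integral {0..1} (\<lambda>t. w t * \<bar>f t\<bar>) = inner_w (\<lambda>_. 1) ?f"
    by (simp add: inner_w_def)
  finally have "\<bar>b t\<bar>\<^sup>2 \<le> (solution_bound k * inner_w (\<lambda>_. 1) ?f)\<^sup>2"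
    by (intro power_mono) auto
  \<comment> \<open>Cauchy-Schwarz against the constant 1, whose squared norm is
    \<open>mass\<close>.\<close>
  also have "\<dots> \<le> (solution_bound k)\<^sup>2 * (mass * inner_w ?f ?f)"
    unfolding power_mult_distrib mass_def
    by (intro mult_left_mono inner_Cauchy_Schwarz pc periodic_continuous_const) auto
  also have "inner_w ?f ?f = inner_w f f"
    by (simp add: inner_w_def mult.assoc)
  finally show ?thesis by simp
qed

end

section \<open>The solution operators at nonzero frequency\<close>

text \<open>The case c = 0 is kept apart because constants solve the homogeneous equation there and
  no inverse exists.\<close>

locale periodic_weight = positive_weight w for w :: "real \<Rightarrow> real" +
  fixes c :: real
  assumes c: "c \<noteq> 0"
begin

text \<open>The choice is harmless: on \<open>periodic_continuous\<close> a solution exists and is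
  unique, and uniqueness makes the chosen map linear.\<close>

definition solve_b :: "(real \<Rightarrow> real) \<Rightarrow> real \<Rightarrow> real" where
  "solve_b f = (SOME b. periodic_solution c (\<lambda>t. - w t * f t) b)"

text \<open>This is the Green operator, the inverse of -(1/w) (d/dt + c) (1/w) (d/dt - c).\<close>

definition solve_a :: "(real \<Rightarrow> real) \<Rightarrow> real \<Rightarrow> real" where
  "solve_a f = (SOME a. periodic_solution (- c) (\<lambda>t. w t * solve_b f t) a)"

lemma solve_b: "f \<in> periodic_continuous \<Longrightarrow> periodic_solution c (\<lambda>t. - w t * f t) (solve_b f)"
  unfolding solve_b_def by (rule someI_ex[OF periodic_solution_exists[OF c periodic_continuous_minus_w_mult]])

lemma periodic_continuous_solve_b: "f \<in> periodic_continuous \<Longrightarrow> solve_b f \<in> periodic_continuous"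
  using solve_b periodic_solution_continuous by blast

lemma solve_a:
  "f \<in> periodic_continuous \<Longrightarrow> periodic_solution (- c) (\<lambda>t. w t * solve_b f t) (solve_a f)"
  unfolding solve_a_def
  using someI_ex[OF periodic_solution_exists[OF _ periodic_continuous_w_mult[OF periodic_continuous_solve_b]], of "- c"] c by simp

lemma periodic_continuous_solve_a: "f \<in> periodic_continuous \<Longrightarrow> solve_a f \<in> periodic_continuous"
  using solve_a periodic_solution_continuous by blast

lemma solve_b_lincomb:
  assumes "f \<in> periodic_continuous" "g \<in> periodic_continuous"
  shows "solve_b (\<lambda>t. x * f t + y * g t) = (\<lambda>t. x * solve_b f t + y * solve_b g t)"
proof (rule periodic_solution_unique[OF c solve_b[OF periodic_continuous_lincomb[OF assms]]])
  have "(\<lambda>t. - w t * (x * f t + y * g t)) = (\<lambda>t. x * (- w t * f t) + y * (- w t * g t))"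
    by (simp add: algebra_simps)
  then show "periodic_solution c (\<lambda>t. - w t * (x * f t + y * g t))
      (\<lambda>t. x * solve_b f t + y * solve_b g t)"
    using periodic_solution_lincomb[OF solve_b[OF assms(1)] solve_b[OF assms(2)]] by simp
qed

lemma solve_a_lincomb:
  assumes "f \<in> periodic_continuous" "g \<in> periodic_continuous"
  shows "solve_a (\<lambda>t. x * f t + y * g t) = (\<lambda>t. x * solve_a f t + y * solve_a g t)"
proof (rule periodic_solution_unique[OF _ solve_a[OF periodic_continuous_lincomb[OF assms]]])
  have "(\<lambda>t. w t * (x * solve_b f t + y * solve_b g t)) =
      (\<lambda>t. x * (w t * solve_b f t) + y * (w t * solve_b g t))"
    by (simp add: algebra_simps)
  then show "periodic_solution (- c) (\<lambda>t. w t * solve_b (\<lambda>t. x * f t + y * g t) t)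
      (\<lambda>t. x * solve_a f t + y * solve_a g t)"
    using periodic_solution_lincomb[OF solve_a[OF assms(1)] solve_a[OF assms(2)]]
    by (simp add: solve_b_lincomb[OF assms])
qed (simp add: c)

lemma inner_solve_b:
  assumes "f \<in> periodic_continuous" "\<psi> \<in> periodic_continuous"
    and "periodic_solution (- c) (\<lambda>t. w t * \<psi> t) \<phi>"
  shows "inner_w f \<phi> = inner_w (solve_b f) \<psi>"
  by (rule inner_periodic_solutions[OF assms solve_b[OF assms(1)]])

text \<open>Writing A for \<open>solve_a\<close> and B for \<open>solve_b\<close>, this says A = B*
  B, so A is symmetric and nonnegative.\<close>

lemma inner_solve_a:
  assumes "f \<in> periodic_continuous" "g \<in> periodic_continuous"
  shows "inner_w f (solve_a g) = inner_w (solve_b f) (solve_b g)"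
  by (rule inner_solve_b[OF assms(1) periodic_continuous_solve_b solve_a]) (rule assms(2))+

lemma solve_b_bound: "\<exists>K>0. \<forall>f\<in>periodic_continuous. \<forall>t. (solve_b f t)\<^sup>2 \<le> K * inner_w f f"
proof (intro exI conjI ballI allI)
  show "0 < (solution_bound c)\<^sup>2 * mass"
    using solution_bound_pos[OF c] mass_pos by simp
  fix f t assume f: "f \<in> periodic_continuous"
  show "(solve_b f t)\<^sup>2 \<le> (solution_bound c)\<^sup>2 * mass * inner_w f f"
    using solution_bound_inner[OF c f solve_b[OF f]] by (simp add: mult.assoc)
qed

lemma solve_b_inner_bound:
  "\<exists>K>0. \<forall>f\<in>periodic_continuous. inner_w (solve_b f) (solve_b f) \<le> K * inner_w f f"
proof -
  obtain K where K: "K > 0" "\<forall>f\<in>periodic_continuous. \<forall>t. (solve_b f t)\<^sup>2 \<le> K * inner_w f f"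
    using solve_b_bound by blast
  have "inner_w (solve_b f) (solve_b f) \<le> mass * K * inner_w f f" if f: "f \<in> periodic_continuous" for f
  proof -
    have "\<bar>solve_b f t\<bar> \<le> sqrt (K * inner_w f f)" for t
      using K(2) f real_le_rsqrt[of "\<bar>solve_b f t\<bar>"] by simp
    from inner_le_of_bound[OF periodic_continuous_solve_b[OF f] this] show ?thesis
      using K(1) inner_nonneg[of f] by (simp add: mult_ac)
  qed
  then show ?thesis using K(1) mass_pos by (intro exI[of _ "mass * K"]) auto
qed

lemma solve_a_bound: "\<exists>K>0. \<forall>f\<in>periodic_continuous. \<forall>t. (solve_a f t)\<^sup>2 \<le> K * inner_w f f"
proof -
  obtain K where K: "K > 0"
    "\<And>f. f \<in> periodic_continuous \<Longrightarrow> inner_w (solve_b f) (solve_b f) \<le> K * inner_w f f"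
    using solve_b_inner_bound by blast
  define L where "L = (solution_bound (- c))\<^sup>2 * mass"
  have L: "L > 0" using mass_pos solution_bound_pos[of "- c"] c by (simp add: L_def)
  have "(solve_a f t)\<^sup>2 \<le> L * K * inner_w f f" if f: "f \<in> periodic_continuous" for f t
  proof -
    have "(solve_a f t)\<^sup>2 \<le> L * inner_w (solve_b f) (solve_b f)"
      using solution_bound_inner[OF _ periodic_continuous_solve_b[OF f] solve_a[OF f]] c
      by (simp add: L_def mult.assoc)
    also have "\<dots> \<le> L * (K * inner_w f f)"
      using L K(2)[OF f] by (intro mult_left_mono) auto
    finally show ?thesis by (simp add: mult.assoc)
  qed
  then show ?thesis using K(1) L by (intro exI[of _ "L * K"]) auto
qed

end

section \<open>The largest eigenvalue of the solution operator\<close>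

context periodic_weight
begin

section \<open>The Rayleigh quotient and its maximising functions\<close>

text \<open>The squared operator norm of \<open>solve_b\<close>, equivalently the supremum of the
  Rayleigh quotient of \<open>solve_a\<close>. Its reciprocal will be the first eigenvalue.\<close>

definition top_value :: real where
  "top_value = (SUP f \<in> {f \<in> periodic_continuous. inner_w f f > 0}.
    inner_w (solve_b f) (solve_b f) / inner_w f f)"

lemma solve_b_inner_le_top:
  assumes "f \<in> periodic_continuous"
  shows "inner_w (solve_b f) (solve_b f) \<le> top_value * inner_w f f"
proof -
  obtain K where K: "K > 0"
    "\<And>f. f \<in> periodic_continuous \<Longrightarrow> inner_w (solve_b f) (solve_b f) \<le> K * inner_w f f"
    using solve_b_inner_bound by blast
  show ?thesis
  proof (cases "inner_w f f > 0")
    case True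
    have "bdd_above ((\<lambda>f. inner_w (solve_b f) (solve_b f) / inner_w f f) `
        {f \<in> periodic_continuous. inner_w f f > 0})"
      using K(2) by (intro bdd_aboveI2[where M = K]) (auto simp: pos_divide_le_eq)
    then have "inner_w (solve_b f) (solve_b f) / inner_w f f \<le> top_value"
      unfolding top_value_def using assms True by (intro cSUP_upper) auto
    then show ?thesis using True by (simp add: pos_divide_le_eq)
  next
    case False
    then have "inner_w f f = 0" using inner_nonneg[of f] by simp
    then show ?thesis using K(2)[OF assms] by simp
  qed
qed

lemma top_value_nonneg: "0 \<le> top_value"
proof -
  have "0 \<le> top_value * mass"
    using solve_b_inner_le_top[OF periodic_continuous_const[of 1]] inner_nonneg[of "solve_b (\<lambda>_. 1)"]
    by (simp add: mass_def)
  then show ?thesis using mass_pos by (simp add: zero_le_mult_iff)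
qed

text \<open>The map from \<psi> to \<phi> is the adjoint of \<open>solve_b\<close>, hence obeys the
  same norm bound: <\<phi>,\<phi>> = <B\<phi>,\<psi>>, followed by Cauchy-Schwarz. This is the
  variational inequality for test functions.\<close>

lemma inner_le_top_mult:
  assumes "\<psi> \<in> periodic_continuous" "periodic_solution (- c) (\<lambda>t. w t * \<psi> t) \<phi>"
  shows "inner_w \<phi> \<phi> \<le> top_value * inner_w \<psi> \<psi>"
proof -
  have pc: "\<phi> \<in> periodic_continuous"
    using assms(2) periodic_solution_continuous by blast
  have "(inner_w \<phi> \<phi>)\<^sup>2 = (inner_w (solve_b \<phi>) \<psi>)\<^sup>2"
    using inner_solve_b[OF pc assms] by simp
  also have "\<dots> \<le> inner_w (solve_b \<phi>) (solve_b \<phi>) * inner_w \<psi> \<psi>"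
    by (intro inner_Cauchy_Schwarz periodic_continuous_solve_b pc assms(1))
  also have "\<dots> \<le> top_value * inner_w \<phi> \<phi> * inner_w \<psi> \<psi>"
    by (intro mult_right_mono solve_b_inner_le_top pc inner_nonneg)
  finally have "inner_w \<phi> \<phi> * inner_w \<phi> \<phi> \<le> inner_w \<phi> \<phi> * (top_value * inner_w \<psi> \<psi>)"
    by (simp add: power2_eq_square mult_ac)
  then show ?thesis
    using inner_nonneg[of \<phi>] inner_nonneg[of \<psi>] top_value_nonneg
    by (cases "inner_w \<phi> \<phi> = 0") (auto simp: mult_le_cancel_left)
qed

lemma top_value_pos: "0 < top_value"
proof (rule ccontr)
  assume "\<not> 0 < top_value"
  then have "top_value = 0" using top_value_nonneg by simp
  \<comment> \<open>The right-hand side is chosen so that the solution is the constant 1, which has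
    positive norm.\<close>
  have "(\<lambda>t. - c / w t) \<in> periodic_continuous"
    using w w_pos by (auto simp: periodic_continuous_def less_imp_neq[symmetric] intro!: continuous_intros)
  moreover have "periodic_solution (- c) (\<lambda>t. w t * (- c / w t)) (\<lambda>_. 1)"
    using w_pos by (auto simp: periodic_solution_def less_imp_neq[symmetric])
  ultimately have "inner_w (\<lambda>_. 1) (\<lambda>_. 1) \<le> 0"
    using inner_le_top_mult \<open>top_value = 0\<close> by fastforce
  then show False using mass_pos by (simp add: mass_def)
qed

lemma inner_solve_a_le:
  assumes f: "f \<in> periodic_continuous"
  shows "inner_w (solve_a f) (solve_a f) \<le> top_value * inner_w (solve_b f) (solve_b f)"
  by (rule inner_le_top_mult[OF periodic_continuous_solve_b[OF f] solve_a[OF f]])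

text \<open>A maximising sequence consists of approximate eigenvectors.\<close>

lemma approximate_eigenvector:
  assumes f: "f \<in> periodic_continuous" "inner_w f f = 1"
    and "top_value - \<epsilon> \<le> inner_w (solve_b f) (solve_b f)"
  shows "inner_w (\<lambda>t. solve_a f t - top_value * f t) (\<lambda>t. solve_a f t - top_value * f t)
    \<le> top_value * \<epsilon>"
proof -
  let ?B = "inner_w (solve_b f) (solve_b f)"
  have "inner_w (\<lambda>t. solve_a f t - top_value * f t) (\<lambda>t. solve_a f t - top_value * f t) =
      inner_w (solve_a f) (solve_a f) - 2 * top_value * ?B + top_value\<^sup>2"
    using inner_square_lincomb[OF periodic_continuous_solve_a[OF f(1)] f(1), of 1 "- top_value"]
      inner_solve_a[OF f(1,1)] f(2)
    by (simp add: inner_commute[of "solve_a f" f])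
  \<comment> \<open>With \<tau> the top value, |Af|^2 \<le> \<tau> |Bf|^2 reduces the three terms to
    \<tau> (\<tau> - |Bf|^2).\<close>
  also have "\<dots> \<le> top_value * (top_value - ?B)"
    using inner_solve_a_le[OF f(1)] by (simp add: power2_eq_square algebra_simps)
  also have "\<dots> \<le> top_value * \<epsilon>"
    using assms(3) top_value_nonneg by (intro mult_left_mono) auto
  finally show ?thesis .
qed

lemma maximising_function:
  assumes "\<epsilon> > 0"
  shows "\<exists>f\<in>periodic_continuous. inner_w f f = 1 \<and>
    top_value - \<epsilon> \<le> inner_w (solve_b f) (solve_b f)"
proof -
  let ?P = "{f \<in> periodic_continuous. inner_w f f > 0}"
  have ne: "?P \<noteq> {}"
    using periodic_continuous_const[of 1] mass_pos by (auto simp: mass_def)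
  have "bdd_above ((\<lambda>f. inner_w (solve_b f) (solve_b f) / inner_w f f) ` ?P)"
    using solve_b_inner_le_top
    by (intro bdd_aboveI2[where M = top_value]) (auto simp: pos_divide_le_eq)
  moreover have "top_value - \<epsilon> < top_value" using assms by simp
  ultimately obtain g where g: "g \<in> ?P"
    "top_value - \<epsilon> < inner_w (solve_b g) (solve_b g) / inner_w g g"
    unfolding top_value_def using less_cSUP_iff[OF ne] by blast
  define s where "s = 1 / sqrt (inner_w g g)"
  \<comment> \<open>The zero summand brings the normalised function into the shape of the two-term
    linearity lemmas.\<close>
  define f where "f = (\<lambda>t. s * g t + 0 * g t)"
  have s: "s\<^sup>2 = 1 / inner_w g g" using g(1) by (simp add: s_def power_divide)
  have pc: "g \<in> periodic_continuous" "f \<in> periodic_continuous"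
    using g(1) periodic_continuous_lincomb[of g g s 0] by (auto simp: f_def)
  have "inner_w f f = 1"
    unfolding f_def inner_square_lincomb[OF pc(1,1)] using g(1) by (simp add: s)
  moreover have "inner_w (solve_b f) (solve_b f) = inner_w (solve_b g) (solve_b g) / inner_w g g"
    unfolding f_def solve_b_lincomb[OF pc(1,1)]
      inner_square_lincomb[OF periodic_continuous_solve_b[OF pc(1)] periodic_continuous_solve_b[OF pc(1)]] by (simp add: s)
  ultimately show ?thesis using g(2) pc(2) by (intro bexI[of _ f]) auto
qed

section \<open>Compactness and attainment of the supremum\<close>

text \<open>L2 bounds on f give sup bounds on Af and Bf, and the equation a' = w b + c a turns these
  into a common Lipschitz constant.\<close>

lemma solve_a_equicontinuous:
  "\<exists>M>0. \<forall>f\<in>periodic_continuous. inner_w f f = 1 \<longrightarrow>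
    (\<forall>t. \<bar>solve_a f t\<bar> \<le> M) \<and> (\<forall>s t. \<bar>solve_a f s - solve_a f t\<bar> \<le> M * \<bar>s - t\<bar>)"
proof -
  obtain K where K: "K > 0" "\<forall>f\<in>periodic_continuous. \<forall>t. (solve_b f t)\<^sup>2 \<le> K * inner_w f f"
    using solve_b_bound by blast
  obtain L where L: "L > 0" "\<forall>f\<in>periodic_continuous. \<forall>t. (solve_a f t)\<^sup>2 \<le> L * inner_w f f"
    using solve_a_bound by blast
  obtain W where W: "W > 0" "\<And>t. \<bar>w t\<bar> \<le> W"
    using periodic_continuous_bounded[OF w] by blast
  \<comment> \<open>The first summand bounds |a|, the bracket bounds |a'|.\<close>
  define M where "M = sqrt L + (W * sqrt K + \<bar>c\<bar> * sqrt L)"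
  have "\<bar>solve_a f t\<bar> \<le> M \<and> \<bar>solve_a f s - solve_a f t\<bar> \<le> M * \<bar>s - t\<bar>"
    if f: "f \<in> periodic_continuous" "inner_w f f = 1" for f s t
  proof -
    have b: "\<bar>solve_b f t\<bar> \<le> sqrt K" for t
      using bspec[OF K(2) f(1)] f(2) real_le_rsqrt[of "\<bar>solve_b f t\<bar>" K] by simp
    have a: "\<bar>solve_a f t\<bar> \<le> sqrt L" for t
      using bspec[OF L(2) f(1)] f(2) real_le_rsqrt[of "\<bar>solve_a f t\<bar>" L] by simp
    have der: "(solve_a f has_real_derivative w t * solve_b f t - (- c) * solve_a f t) (at t)" for t
      using solve_a[OF f(1)] by (simp add: periodic_solution_def)
    have "norm (w t * solve_b f t - (- c) * solve_a f t) \<le> M" for t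
    proof -
      have "\<bar>w t * solve_b f t\<bar> \<le> W * sqrt K" "\<bar>c * solve_a f t\<bar> \<le> \<bar>c\<bar> * sqrt L"
        unfolding abs_mult using W K(1) a b by (auto intro!: mult_mono)
      moreover have "w t * solve_b f t - (- c) * solve_a f t = w t * solve_b f t + c * solve_a f t"
        by simp
      ultimately show ?thesis
        using L(1) real_sqrt_gt_zero[of L] unfolding M_def real_norm_def by linarith
    qed
    then have "norm (solve_a f s - solve_a f t) \<le> M * norm (s - t)"
      using der by (intro field_differentiable_bound[of UNIV]) auto
    moreover have "sqrt L \<le> M" using W(1) K(1) L(1) by (simp add: M_def)
    ultimately show ?thesis using a[of t] by auto
  qed
  moreover have "M > 0" using W(1) K(1) L(1) by (simp add: M_def add_pos_nonneg)
  ultimately show ?thesis by blast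
qed

lemma tendsto_zero_of_square_bound:
  fixes x y :: "nat \<Rightarrow> real"
  assumes "\<And>n. (x n)\<^sup>2 \<le> K * y n" "y \<longlonglongrightarrow> 0"
  shows "x \<longlonglongrightarrow> 0"
proof -
  have "(\<lambda>n. K * y n) \<longlonglongrightarrow> 0"
    using tendsto_mult_left[OF assms(2), of K] by simp
  then have "(\<lambda>n. (x n)\<^sup>2) \<longlonglongrightarrow> 0"
    using assms(1) by (rule_tac tendsto_sandwich[of "\<lambda>_. 0"]) auto
  then have "(\<lambda>n. sqrt ((x n)\<^sup>2)) \<longlonglongrightarrow> sqrt 0"
    by (rule tendsto_real_sqrt)
  then show ?thesis by (simp add: tendsto_rabs_zero_iff)
qed

text \<open>The maximising functions f_n themselves need not converge, but a subsequence of A f_n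
  converges uniformly to some a. Since A f_n - \<tau> f_n tends to 0 in L2, applying A once more
  gives A a = \<tau> a in the limit.\<close>

lemma top_eigenfunction:
  "\<exists>a\<in>periodic_continuous. (\<exists>t. a t \<noteq> 0) \<and> solve_a a = (\<lambda>t. top_value * a t)"
proof -
  have "\<exists>f\<in>periodic_continuous. inner_w f f = 1 \<and>
      top_value - inverse (real (Suc n)) \<le> inner_w (solve_b f) (solve_b f)" for n
    by (rule maximising_function) simp
  then obtain f where f: "\<And>n. f n \<in> periodic_continuous" "\<And>n. inner_w (f n) (f n) = 1"
    "\<And>n. top_value - inverse (real (Suc n)) \<le> inner_w (solve_b (f n)) (solve_b (f n))"
    by metis
  obtain M where M: "M > 0" "\<And>n t. \<bar>solve_a (f n) t\<bar> \<le> M"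
    "\<And>n s t. \<bar>solve_a (f n) s - solve_a (f n) t\<bar> \<le> M * \<bar>s - t\<bar>"
    using solve_a_equicontinuous f(1,2) by meson
  have equi: "\<exists>d>0. \<forall>n y. y \<in> {0..1} \<and> norm (x - y) < d \<longrightarrow>
      norm (solve_a (f n) x - solve_a (f n) y) < e" if "0 < e" for x e :: real
  proof (intro exI conjI allI impI)
    show "0 < e / M" using that M(1) by simp
    fix n y assume "y \<in> {0..1} \<and> norm (x - y) < e / M"
    then have "M * \<bar>x - y\<bar> < e" using M(1) by (simp add: pos_less_divide_eq mult.commute)
    then show "norm (solve_a (f n) x - solve_a (f n) y) < e"
      using M(3)[of n x y] by simp
  qed
  obtain g k where k: "strict_mono (k :: nat \<Rightarrow> nat)"
    and g: "\<And>e. 0 < e \<Longrightarrow>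
      \<exists>N. \<forall>n x. n \<ge> N \<and> x \<in> {0..1} \<longrightarrow> norm (solve_a (f (k n)) x - g x) < e"
    by (rule Arzela_Ascoli[of "{0..1::real}" "\<lambda>n. solve_a (f n)" M])
      (use M(2) equi in auto)
  \<comment> \<open>The limit on [0,1] is extended periodically; continuity across the integers
    comes from uniform convergence of periodic functions on the whole line.\<close>
  define a where "a = (\<lambda>t. g (frac t))"
  define F where "F = (\<lambda>n. f (k n))"
  have F: "F n \<in> periodic_continuous" "inner_w (F n) (F n) = 1" for n
    using f by (auto simp: F_def)
  have per: "solve_a (F n) (frac t) = solve_a (F n) t" for n t
    using periodic_continuous_solve_a[OF F(1)] by (intro periodic_reduce) (simp add: periodic_continuous_def)
  have lim: "\<exists>N. \<forall>n\<ge>N. \<forall>t. \<bar>solve_a (F n) t - a t\<bar> < e" if e: "0 < e" for e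
  proof -
    obtain N where "\<forall>n x. n \<ge> N \<and> x \<in> {0..1} \<longrightarrow> norm (solve_a (f (k n)) x - g x) < e"
      using g[OF e] by blast
    then have "\<bar>solve_a (F n) (frac t) - g (frac t)\<bar> < e" if "n \<ge> N" for n t
      using that frac_lt_1[of t] frac_ge_0[of t] by (simp add: F_def less_imp_le)
    then show ?thesis using per by (auto simp: a_def)
  qed
  have "uniform_limit UNIV (\<lambda>n. solve_a (F n)) a sequentially"
    unfolding uniform_limit_sequentially_iff using lim by (simp add: dist_real_def)
  then have "continuous_on UNIV a"
    by (rule uniform_limit_theorem[rotated])
      (simp_all add: periodic_continuous_imp_continuous_on periodic_continuous_solve_a F)
  then have a: "a \<in> periodic_continuous"
    by (simp add: periodic_continuous_def a_def frac_1_eq)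
  define D where "D = (\<lambda>n. inner_w (\<lambda>t. solve_a (F n) t - a t) (\<lambda>t. solve_a (F n) t - a t))"
  have pcD: "(\<lambda>t. solve_a (F n) t - a t) \<in> periodic_continuous" for n
    using periodic_continuous_lincomb[OF periodic_continuous_solve_a[OF F(1)[of n]] a, of 1 "-1"] by simp
  have "D \<longlonglongrightarrow> 0"
  proof (rule LIMSEQ_I)
    fix r :: real assume r: "0 < r"
    \<comment> \<open>A uniform distance \<open>e\<close> costs at most e^2 \<open>mass\<close> =
      r/2 in the squared L2 norm.\<close>
    define e where "e = sqrt (r / (2 * mass))"
    have e: "e > 0" "e\<^sup>2 * mass < r" using r mass_pos by (auto simp: e_def)
    obtain N where "\<forall>n\<ge>N. \<forall>t. \<bar>solve_a (F n) t - a t\<bar> < e"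
      using lim[OF e(1)] by blast
    then have "D n \<le> e\<^sup>2 * mass" if "n \<ge> N" for n
      unfolding D_def using that by (intro inner_le_of_bound pcD) (simp add: less_imp_le)
    then have "norm (D n - 0) < r" if "n \<ge> N" for n
      using that e(2) inner_nonneg[of "\<lambda>t. solve_a (F n) t - a t"] by (fastforce simp: D_def)
    then show "\<exists>no. \<forall>n\<ge>no. norm (D n - 0) < r" by blast
  qed
  have inv: "(\<lambda>n. inverse (real (Suc (k n)))) \<longlonglongrightarrow> 0"
    using LIMSEQ_subseq_LIMSEQ[OF LIMSEQ_inverse_real_of_nat k] by (simp add: o_def)
  define E where "E = (\<lambda>n. inner_w (\<lambda>t. solve_a (F n) t - top_value * F n t)
    (\<lambda>t. solve_a (F n) t - top_value * F n t))"
  have pcE: "(\<lambda>t. solve_a (F n) t - top_value * F n t) \<in> periodic_continuous" for n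
    using periodic_continuous_lincomb[OF periodic_continuous_solve_a[OF F(1)[of n]] F(1)[of n], of 1 "- top_value"] by simp
  have "E n \<le> top_value * inverse (real (Suc (k n)))" for n
    unfolding E_def F_def by (intro approximate_eigenvector f)
  moreover have "(\<lambda>n. top_value * inverse (real (Suc (k n)))) \<longlonglongrightarrow> 0"
    using tendsto_mult_left[OF inv, of top_value] by simp
  ultimately have "E \<longlonglongrightarrow> 0"
    using inner_nonneg unfolding E_def by (rule_tac tendsto_sandwich[of "\<lambda>_. 0"]) auto
  obtain K where K: "\<And>f t. f \<in> periodic_continuous \<Longrightarrow> (solve_a f t)\<^sup>2 \<le> K * inner_w f f"
    using solve_a_bound by blast
  have "solve_a a t = top_value * a t" for t
  proof -
    have 1: "(\<lambda>n. solve_a (\<lambda>t. solve_a (F n) t - a t) t) \<longlonglongrightarrow> 0"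
      using K[OF pcD] \<open>D \<longlonglongrightarrow> 0\<close> unfolding D_def by (rule tendsto_zero_of_square_bound)
    have 2: "(\<lambda>n. solve_a (\<lambda>t. solve_a (F n) t - top_value * F n t) t) \<longlonglongrightarrow> 0"
      using K[OF pcE] \<open>E \<longlonglongrightarrow> 0\<close> unfolding E_def by (rule tendsto_zero_of_square_bound)
    have "(\<lambda>n. solve_a (F n) t) \<longlonglongrightarrow> a t"
      using lim by (intro LIMSEQ_I) (simp, meson)
    then have 3: "(\<lambda>n. top_value * (solve_a (F n) t)) \<longlonglongrightarrow> top_value * a t"
      by (rule tendsto_mult_left)
    \<comment> \<open>By linearity both the terms A A F_n and the terms \<tau> A F_n cancel.\<close>
    have "solve_a (\<lambda>t. solve_a (F n) t - a t) t
        - solve_a (\<lambda>t. solve_a (F n) t - top_value * F n t) t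
        - top_value * solve_a (F n) t = - solve_a a t" for n
      using solve_a_lincomb[OF periodic_continuous_solve_a[OF F(1)[of n]] a, of 1 "-1"]
        solve_a_lincomb[OF periodic_continuous_solve_a[OF F(1)[of n]] F(1)[of n], of 1 "- top_value"]
      by simp
    with tendsto_diff[OF tendsto_diff[OF 1 2] 3]
    have "(\<lambda>n. - solve_a a t) \<longlonglongrightarrow> 0 - 0 - top_value * a t" by simp
    then show ?thesis using LIMSEQ_unique[OF _ tendsto_const] by fastforce
  qed
  \<comment> \<open>If a = 0, then A F_n tends to 0 in L2, and so does |B F_n|^2 = <F_n, A F_n>; but
    these values approach the positive \<open>top_value\<close>.\<close>
  moreover have "\<exists>t. a t \<noteq> 0"
  proof (rule ccontr)
    assume "\<not> (\<exists>t. a t \<noteq> 0)"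
    then have D: "D n = inner_w (solve_a (F n)) (solve_a (F n))" for n by (simp add: D_def)
    define V where "V = (\<lambda>n. inner_w (solve_b (F n)) (solve_b (F n)))"
    have "(V n)\<^sup>2 \<le> 1 * D n" for n
      using inner_Cauchy_Schwarz[OF F(1)[of n] periodic_continuous_solve_a[OF F(1)[of n]]]
      by (simp add: D V_def inner_solve_a F)
    then have "V \<longlonglongrightarrow> 0"
      using \<open>D \<longlonglongrightarrow> 0\<close> by (rule tendsto_zero_of_square_bound)
    moreover have "(\<lambda>n. top_value - inverse (real (Suc (k n)))) \<longlonglongrightarrow> top_value - 0"
      by (intro tendsto_diff tendsto_const inv)
    moreover have "top_value - inverse (real (Suc (k n))) \<le> V n" for n
      using f(3) by (simp add: V_def F_def)
    ultimately have "top_value - 0 \<le> 0"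
      by (intro LIMSEQ_le) auto
    then show False using top_value_pos by simp
  qed
  ultimately show ?thesis using a by blast
qed

lemma first_eigenfunction_exists_nonzero:
  "\<exists>\<mu> a b. (\<exists>t. a t \<noteq> 0) \<and>
    periodic_solution (- c) (\<lambda>t. w t * b t) a \<and>
    periodic_solution c (\<lambda>t. - \<mu> * w t * a t) b \<and>
    (\<forall>\<phi> \<psi>. \<psi> \<in> periodic_continuous \<longrightarrow> periodic_solution (- c) (\<lambda>t. w t * \<psi> t) \<phi> \<longrightarrow>
      \<mu> * inner_w \<phi> \<phi> \<le> inner_w \<psi> \<psi>)"
proof -
  obtain a where a: "a \<in> periodic_continuous" "\<exists>t. a t \<noteq> 0"
    "solve_a a = (\<lambda>t. top_value * a t)"
    using top_eigenfunction by blast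
  define \<mu> where "\<mu> = 1 / top_value"
  have \<mu>: "\<mu> > 0" "\<mu> * top_value = 1" using top_value_pos by (auto simp: \<mu>_def)
  \<comment> \<open>Scaling by \<mu> makes A a = \<tau> a into the system itself: \<mu> A a = a is
    the solution driven by w b.\<close>
  define b where "b = (\<lambda>t. \<mu> * solve_b a t)"
  have "(\<lambda>t. \<mu> * solve_a a t) = a"
    using \<mu>(2) by (simp add: a(3) flip: mult.assoc)
  then have "periodic_solution (- c) (\<lambda>t. w t * b t) a"
    using periodic_solution_lincomb[OF solve_a[OF a(1)] solve_a[OF a(1)], of \<mu> 0]
    by (simp add: b_def mult_ac)
  moreover have "periodic_solution c (\<lambda>t. - \<mu> * w t * a t) b"
    using periodic_solution_lincomb[OF solve_b[OF a(1)] solve_b[OF a(1)], of \<mu> 0]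
    by (simp add: b_def mult_ac)
  moreover have "\<mu> * inner_w \<phi> \<phi> \<le> inner_w \<psi> \<psi>"
    if "\<psi> \<in> periodic_continuous" "periodic_solution (- c) (\<lambda>t. w t * \<psi> t) \<phi>" for \<phi> \<psi>
    using inner_le_top_mult[OF that] top_value_pos
    by (simp add: \<mu>_def pos_divide_le_eq mult.commute)
  ultimately show ?thesis using a(2) by blast
qed

end

text \<open>The number \<open>\<mu>\<close> below is the bottom of the spectrum of the periodic problem
  \<open>- (d/dt + c) (1/w) (d/dt - c) a = \<mu> w a\<close>.\<close>

lemma (in positive_weight) first_eigenfunction_exists:
  "\<exists>\<mu> a b. (\<exists>t. a t \<noteq> 0) \<and>
    periodic_solution (- c) (\<lambda>t. w t * b t) a \<and>
    periodic_solution c (\<lambda>t. - \<mu> * w t * a t) b \<and>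
    (\<forall>\<phi> \<psi>. \<psi> \<in> periodic_continuous \<longrightarrow> periodic_solution (- c) (\<lambda>t. w t * \<psi> t) \<phi> \<longrightarrow>
      \<mu> * inner_w \<phi> \<phi> \<le> inner_w \<psi> \<psi>)"
proof (cases "c = 0")
  case True
  \<comment> \<open>At frequency 0 the constants are harmonic, with \<mu> = 0 and b = 0.\<close>
  have "periodic_solution (- c) (\<lambda>t. w t * 0) (\<lambda>_. 1)"
    "periodic_solution c (\<lambda>t. - 0 * w t * 1) (\<lambda>_. 0)"
    by (auto simp: periodic_solution_def True)
  then show ?thesis using inner_nonneg
    by (intro exI[of _ 0] exI[of _ "\<lambda>_. 1"] exI[of _ "\<lambda>_. 0"]) simp
next
  case False
  then interpret periodic_weight w c by unfold_locales
  show ?thesis by (rule first_eigenfunction_exists_nonzero)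
qed

section \<open>The first eigenvalue of the Dirac operator\<close>

lemma periodic_derivative:
  fixes f :: "real \<Rightarrow> real"
  assumes "\<And>t. (f has_real_derivative d t) (at t)" "\<And>t. f (t + 1) = f t"
  shows "d (t + 1) = d t"
proof -
  have "((\<lambda>t. f (t + 1)) has_real_derivative d (t + 1)) (at t)"
    using assms(1)[of "t + 1"] by (simp add: DERIV_shift)
  then show ?thesis using DERIV_unique[OF _ assms(1)] assms(2) by simp
qed

lemma cis_weight: "cis (2 * pi * of_int l * s) = exp (2 * of_real pi * \<i> * of_int l * of_real s)"
  by (simp add: cis_conv_exp mult_ac)

section \<open>Eigenspinors of weight l as periodic solutions of a first-order system\<close>

locale torus_conformal_factor =
  fixes h h' :: "real \<Rightarrow> real"
  assumes times_h: "\<And>k. times_differentiable k h"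
    and der: "\<And>t. (h has_real_derivative h' t) (at t)"
    and times_h': "\<And>k. times_differentiable k h'"
    and per: "\<And>t. h (t + 1) = h t"
    and pos: "\<And>t. h t > 0"
begin

lemma nonzero: "h t \<noteq> 0"
  using pos[of t] by simp

text \<open>The area density of the metric is h^4. Writing a spinor component as a/h divides it by
  h^2, which leaves the weight h^2.\<close>

sublocale positive_weight "\<lambda>t. (h t)\<^sup>2"
proof
  show "(\<lambda>t. (h t)\<^sup>2) \<in> periodic_continuous"
    using DERIV_continuous_on[of UNIV h h'] der per
    by (auto simp: periodic_continuous_def intro!: continuous_intros)
qed (simp add: nonzero)

lemma times_inverse: "times_differentiable k (\<lambda>t. inverse (h t))"
  by (rule times_differentiable_inverse[OF times_h nonzero])

text \<open>Bootstrapping: the system expresses a' and b' through a, b and h, so each round gains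
  one order.\<close>

lemma solution_times_differentiable:
  assumes a: "periodic_solution (- c) (\<lambda>t. (h t)\<^sup>2 * b t) a"
    and b: "periodic_solution c (\<lambda>t. - \<mu> * (h t)\<^sup>2 * a t) b"
  shows "times_differentiable k a \<and> times_differentiable k b"
proof (induction k)
  case (Suc k)
  have "times_differentiable (Suc k) a"
  proof (rule times_differentiable_SucI)
    show "(a has_vector_derivative h t * h t * b t + c * a t) (at t)" for t
      using a by (simp add: periodic_solution_def power2_eq_square
          has_real_derivative_iff_has_vector_derivative)
    show "times_differentiable k (\<lambda>t. h t * h t * b t + c * a t)"
      using Suc times_h by (intro times_differentiable_add times_differentiable_mult
          times_differentiable_const) auto
  qed
  moreover have "times_differentiable (Suc k) b"
  proof (rule times_differentiable_SucI)
    show "(b has_vector_derivative - \<mu> * (h t * h t * a t) + - c * b t) (at t)" for t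
      using b by (simp add: periodic_solution_def power2_eq_square mult.assoc
          has_real_derivative_iff_has_vector_derivative)
    show "times_differentiable k (\<lambda>t. - \<mu> * (h t * h t * a t) + - c * b t)"
      using Suc times_h by (intro times_differentiable_add times_differentiable_mult
          times_differentiable_const) auto
  qed
  ultimately show ?case by simp
qed simp

lemma quotient_has_derivative:
  assumes "(a has_real_derivative a') (at t)"
  shows "((\<lambda>t. complex_of_real (a t / h t)) has_vector_derivative
    of_real ((a' - h' t / h t * a t) / h t)) (at t)"
proof -
  have "((\<lambda>t. a t / h t) has_real_derivative (a' - h' t / h t * a t) / h t) (at t)"
    using nonzero[of t] by (auto intro!: derivative_eq_intros assms der simp: field_simps)
  then show ?thesis
    by (intro bounded_linear.has_vector_derivative[OF bounded_linear_of_real])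
      (simp add: has_real_derivative_iff_has_vector_derivative)
qed

text \<open>The components of the eigenspinor are \<open>a / h\<close> and \<open>b / h\<close>: multiplication by \<open>h\<close>
  removes the zeroth order term of the Dirac operator of \<open>h\<^sup>4 (dt\<^sup>2 + dy\<^sup>2)\<close>.\<close>

lemma contains_weight_of_solution:
  assumes a: "periodic_solution (- c) (\<lambda>t. (h t)\<^sup>2 * b t) a"
    and b: "periodic_solution c (\<lambda>t. - \<mu> * (h t)\<^sup>2 * a t) b"
    and nz: "\<exists>t. a t \<noteq> 0" and c: "c = 2 * pi * of_int l"
  shows "contains_weight (eigenspace h \<mu>) l"
proof -
  define A B where "A = (\<lambda>t. complex_of_real (a t / h t))" and "B = (\<lambda>t. complex_of_real (b t / h t))"
  have A': "(A has_vector_derivative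
      of_real (((h t)\<^sup>2 * b t + c * a t - h' t / h t * a t) / h t)) (at t)" for t
    unfolding A_def using a by (intro quotient_has_derivative) (simp add: periodic_solution_def)
  have B': "(B has_vector_derivative
      of_real ((- \<mu> * (h t)\<^sup>2 * a t - c * b t - h' t / h t * b t) / h t)) (at t)" for t
    unfolding B_def using b by (intro quotient_has_derivative) (simp add: periodic_solution_def)
  have "(\<lambda>t. (1 / (h t)\<^sup>2) *\<^sub>R (complex_of_real (((h t)\<^sup>2 * b t + c * a t - h' t / h t * a t) / h t)
      + (h' t / h t - c) *\<^sub>R A t)) = B"
    unfolding A_def B_def scaleR_conv_of_real of_real_mult[symmetric] of_real_add[symmetric]
    using nonzero by (intro ext arg_cong[of _ _ of_real]) (simp add: field_simps power2_eq_square)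
  then have 1: "torus_dirac h (mode c 1 A) = mode c 2 B"
    using torus_dirac_mode_1[OF pos der A'] by simp
  have "(\<lambda>t. - (1 / (h t)\<^sup>2) *\<^sub>R (complex_of_real
      ((- \<mu> * (h t)\<^sup>2 * a t - c * b t - h' t / h t * b t) / h t)
      + (h' t / h t + c) *\<^sub>R B t)) = (\<lambda>t. \<mu> *\<^sub>R A t)"
    unfolding A_def B_def scaleR_conv_of_real of_real_mult[symmetric] of_real_add[symmetric]
    using nonzero by (intro ext arg_cong[of _ _ of_real]) (simp add: field_simps power2_eq_square)
  then have 2: "torus_dirac h (mode c 2 B) = mode c 1 (\<lambda>t. \<mu> *\<^sub>R A t)"
    using torus_dirac_mode_2[OF pos der B'] by simp
  have "times_differentiable k A" for k
    unfolding A_def divide_inverse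
    by (intro times_differentiable_linear[OF bounded_linear_of_real] times_differentiable_mult
        times_inverse conjunct1[OF solution_times_differentiable[OF a b]])
  then have smooth: "smooth (mode c 1 A)"
    by (rule smooth_mode)
  have weight: "mode c 1 A (t, y + s) =
      exp (2 * of_real pi * \<i> * of_int l * of_real s) *s mode c 1 A (t, y)" for s t y
    by (simp add: mode_def c flip: cis_weight)
      (simp add: vec_eq_iff axis_def vector_scalar_mult_def distrib_left mult_ac flip: cis_mult)
  \<comment> \<open>Integrality of the weight gives periodicity in y.\<close>
  have "exp (2 * of_real pi * \<i> * of_int l * of_real 1) = 1"
    using cis_weight[of l 1] cis_multiple_2pi[of "of_int l"] by simp
  then have "mode c 1 A (t, y + 1) = mode c 1 A (t, y)" for t y
    using weight[of t y 1] by simp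
  moreover have "mode c 1 A (t + 1, y) = mode c 1 A (t, y)" for t y
    using a by (simp add: mode_def A_def per periodic_solution_def)
  ultimately have "mode c 1 A \<in> torus_spinors"
    using smooth by (simp add: torus_spinors_def)
  moreover have "mode c 1 A p \<in> S_plus" for p
    by (simp add: mem_S_plus_iff mode_def axis_def)
  moreover have "torus_dirac h (torus_dirac h (mode c 1 A)) p = \<mu> *\<^sub>R mode c 1 A p" for p
    unfolding 1 2 by (simp add: mode_def vec_eq_iff axis_def)
  ultimately have "mode c 1 A \<in> eigenspace h \<mu>"
    by (simp add: eigenspace_def)
  moreover obtain t where "a t \<noteq> 0" using nz by blast
  then have "mode c 1 A (t, 0) \<noteq> 0"
    using nonzero by (simp add: mode_def A_def vec_eq_iff axis_def)
  ultimately show ?thesis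
    unfolding contains_weight_def using weight by blast
qed

text \<open>Converse passage: the weight condition forces a single mode with complex profile F, and
  G is the profile of its image under the Dirac operator. The equations have real coefficients, so a
  real or imaginary part already yields a nontrivial real solution.\<close>

lemma solution_of_contains_weight:
  assumes "contains_weight (eigenspace h \<mu>) l" and c: "c = 2 * pi * of_int l"
  shows "\<exists>a b. (\<exists>t. a t \<noteq> 0) \<and> periodic_solution (- c) (\<lambda>t. (h t)\<^sup>2 * b t) a \<and>
    periodic_solution c (\<lambda>t. - \<mu> * (h t)\<^sup>2 * a t) b"
proof -
  obtain \<psi> p0 where \<psi>: "\<psi> \<in> eigenspace h \<mu>" "\<psi> p0 \<noteq> 0"
    and weight: "\<And>s t y. \<psi> (t, y + s) =
      exp (2 * of_real pi * \<i> * of_int l * of_real s) *s \<psi> (t, y)"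
    using assms(1) unfolding contains_weight_def by blast
  have smooth: "smooth \<psi>" and \<psi>_per: "\<And>t y. \<psi> (t + 1, y) = \<psi> (t, y)"
    and plus: "\<And>p. \<psi> p $ 2 = 0" and eigen: "\<And>p. torus_dirac h (torus_dirac h \<psi>) p = \<mu> *\<^sub>R \<psi> p"
    using \<psi>(1) by (auto simp: eigenspace_def torus_spinors_def mem_S_plus_iff)
  define F where "F = (\<lambda>t. \<psi> (t, 0) $ 1)"
  have \<psi>_eq: "\<psi> = mode c 1 F"
  proof
    fix p :: point
    obtain t y where p: "p = (t, y)" by (cases p)
    show "\<psi> p = mode c 1 F p"
      using weight[of t 0 y] plus
      by (simp add: p mode_def F_def c cis_weight vec_eq_iff forall_2 axis_def vector_scalar_mult_def)
  qed
  have "times_differentiable k F" for k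
    using times_differentiable_linear[OF bounded_linear_vec_nth
        smooth_along_line[OF smooth, where p = "(0, 0)" and v = "(1, 0)"]]
    by (simp add: F_def)
  then obtain F' where F': "\<And>t. (F has_vector_derivative F' t) (at t)"
    and F: "\<And>k. times_differentiable k F" "\<And>k. times_differentiable k F'"
    using all_times_differentiable_derivative by metis
  define G where "G = (\<lambda>t. (1 / (h t)\<^sup>2) *\<^sub>R (F' t + (h' t / h t - c) *\<^sub>R F t))"
  have "G = (\<lambda>t. of_real (inverse (h t) * inverse (h t)) *
      (F' t + of_real (h' t * inverse (h t) + - c) * F t))"
    by (simp add: G_def scaleR_conv_of_real divide_inverse power2_eq_square)
  then have "times_differentiable k G" for k
    by (simp only:) (intro times_differentiable_linear[OF bounded_linear_of_real]
      times_differentiable_mult times_differentiable_add times_inverse times_h'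
      times_differentiable_const F)
  then obtain G' where G': "\<And>t. (G has_vector_derivative G' t) (at t)"
    using all_times_differentiable_derivative by metis
  have "torus_dirac h (torus_dirac h \<psi>) =
      mode c 1 (\<lambda>t. - (1 / (h t)\<^sup>2) *\<^sub>R (G' t + (h' t / h t + c) *\<^sub>R G t))"
    unfolding \<psi>_eq torus_dirac_mode_1[OF pos der F'] G_def[symmetric]
    by (rule torus_dirac_mode_2[OF pos der G'])
  then have eq: "- (1 / (h t)\<^sup>2) *\<^sub>R (G' t + (h' t / h t + c) *\<^sub>R G t) = \<mu> *\<^sub>R F t" for t
    using eigen[of "(t, 0)"] by (simp add: mode_def \<psi>_eq vec_eq_iff forall_2 axis_def)
  obtain t0 where "F t0 \<noteq> 0"
    using \<psi>(2) unfolding \<psi>_eq by (auto simp: mode_def vec_eq_iff axis_def split: if_splits)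
  \<comment> \<open>\<open>L\<close> is \<open>Re\<close> or \<open>Im\<close>, whichever is nonzero
    on \<open>F t0\<close>; real linearity carries the equations over.\<close>
  then obtain L :: "complex \<Rightarrow> real" where L: "bounded_linear L" "L (F t0) \<noteq> 0"
    using complex_eq_iff bounded_linear_Re bounded_linear_Im by (metis zero_complex.sel)
  note lin = linear_add[OF bounded_linear.linear[OF L(1)]] linear_cmul[OF bounded_linear.linear[OF L(1)]]
  define u g where "u = (\<lambda>t. L (F t))" and "g = (\<lambda>t. L (G t))"
  define a b where "a = (\<lambda>t. h t * u t)" and "b = (\<lambda>t. h t * g t)"
  have u: "(u has_real_derivative L (F' t)) (at t)" for t
    using bounded_linear.has_vector_derivative[OF L(1) F']
    by (simp add: u_def has_real_derivative_iff_has_vector_derivative)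
  have g: "(g has_real_derivative L (G' t)) (at t)" for t
    using bounded_linear.has_vector_derivative[OF L(1) G']
    by (simp add: g_def has_real_derivative_iff_has_vector_derivative)
  have g_eq: "g t = (1 / (h t)\<^sup>2) * (L (F' t) + (h' t / h t - c) * u t)" for t
    by (simp only: g_def G_def lin u_def real_scaleR_def)
  have u_eq: "- (1 / (h t)\<^sup>2) * (L (G' t) + (h' t / h t + c) * g t) = \<mu> * u t" for t
    using arg_cong[OF eq[of t], of L] by (simp only: lin u_def g_def real_scaleR_def)
  have LF: "L (F' t) = (h t)\<^sup>2 * g t - (h' t / h t - c) * u t" for t
    unfolding g_eq using nonzero[of t] by simp
  have "h' t * u t + L (F' t) * h t = (h t)\<^sup>2 * b t - (- c) * a t" for t
    unfolding LF a_def b_def using nonzero[of t] by (simp add: field_simps power2_eq_square)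
  moreover have "(a has_real_derivative h' t * u t + L (F' t) * h t) (at t)" for t
    unfolding a_def by (rule DERIV_mult[OF der u])
  ultimately have a_der: "(a has_real_derivative (h t)\<^sup>2 * b t - (- c) * a t) (at t)" for t
    by simp
  have LG: "L (G' t) = - (h t)\<^sup>2 * (\<mu> * u t) - (h' t / h t + c) * g t" for t
    unfolding u_eq[symmetric] using nonzero[of t] by simp
  have "h' t * g t + L (G' t) * h t = - \<mu> * (h t)\<^sup>2 * a t - c * b t" for t
    unfolding LG a_def b_def using nonzero[of t] by (simp add: field_simps power2_eq_square)
  moreover have "(b has_real_derivative h' t * g t + L (G' t) * h t) (at t)" for t
    unfolding b_def by (rule DERIV_mult[OF der g])
  ultimately have b_der: "(b has_real_derivative - \<mu> * (h t)\<^sup>2 * a t - c * b t) (at t)" for t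
    by simp
  have a_per: "a (t + 1) = a t" for t
    by (simp add: a_def u_def F_def per \<psi>_per)
  \<comment> \<open>Periodicity of b is read off the first equation, where all other terms are
    periodic and h^2 is nonzero.\<close>
  have "(h t)\<^sup>2 * b (t + 1) = (h t)\<^sup>2 * b t" for t
    using periodic_derivative[OF a_der a_per, of t] by (simp add: per a_per)
  then have b_per: "b (t + 1) = b t" for t
    by (simp add: nonzero)
  have "a t0 \<noteq> 0" using L(2) nonzero by (simp add: a_def u_def)
  then show ?thesis
    using a_der b_der a_per b_per unfolding periodic_solution_def by blast
qed

section \<open>The variational bound for the first eigenvalue\<close>

text \<open>\<open>LEAST\<close> is useful only if the minimum is attained, which
  \<open>first_eigenfunction_exists\<close> ensures. Any other eigenvalue \<nu> is compared with
  \<mu> by using its own solution (a, b) as the test pair.\<close>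

lemma first_eigenvalue_le:
  assumes \<psi>: "\<psi> \<in> periodic_continuous"
    and \<phi>: "periodic_solution (- (2 * pi * of_int l)) (\<lambda>t. (h t)\<^sup>2 * \<psi> t) \<phi>"
    and nz: "\<phi> t0 \<noteq> 0"
  shows "first_eigenvalue h l \<le> inner_w \<psi> \<psi> / inner_w \<phi> \<phi>"
proof -
  define c where "c = 2 * pi * real_of_int l"
  obtain \<mu> a b where nz_a: "\<exists>t. a t \<noteq> 0"
    and a: "periodic_solution (- c) (\<lambda>t. (h t)\<^sup>2 * b t) a"
    and b: "periodic_solution c (\<lambda>t. - \<mu> * (h t)\<^sup>2 * a t) b"
    and least: "\<And>\<phi> \<psi>. \<psi> \<in> periodic_continuous \<Longrightarrow>
      periodic_solution (- c) (\<lambda>t. (h t)\<^sup>2 * \<psi> t) \<phi> \<Longrightarrow> \<mu> * inner_w \<phi> \<phi> \<le> inner_w \<psi> \<psi>"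
    using first_eigenfunction_exists[of c] by blast
  have "first_eigenvalue h l = \<mu>"
    unfolding first_eigenvalue_def
  proof (rule Least_equality)
    show "contains_weight (eigenspace h \<mu>) l"
      by (rule contains_weight_of_solution[OF a b nz_a c_def])
    fix \<nu> assume "contains_weight (eigenspace h \<nu>) l"
    then obtain a b t where "a t \<noteq> 0"
      and a: "periodic_solution (- c) (\<lambda>t. (h t)\<^sup>2 * b t) a"
      and b: "periodic_solution c (\<lambda>t. - \<nu> * (h t)\<^sup>2 * a t) b"
      using solution_of_contains_weight[OF _ c_def] by blast
    have pc: "a \<in> periodic_continuous" "b \<in> periodic_continuous"
      using a b periodic_solution_continuous by blast+
    \<comment> \<open>Read with f = \<nu> a, adjointness of the two equations gives \<nu> <a,a> =
      <b,b>, so the variational inequality yields \<mu> <a,a> \<le> \<nu> <a,a>.\<close>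
    have "(\<lambda>t. - \<nu> * (h t)\<^sup>2 * a t) = (\<lambda>t. - (h t)\<^sup>2 * (\<nu> * a t + 0 * a t))"
      by (simp add: algebra_simps)
    then have "inner_w (\<lambda>t. \<nu> * a t + 0 * a t) a = inner_w b b"
      using b by (intro inner_periodic_solutions[OF periodic_continuous_lincomb[OF pc(1,1)] pc(2) a]) simp
    then have "\<mu> * inner_w a a \<le> \<nu> * inner_w a a"
      using least[OF pc(2) a] inner_lincomb[OF pc(1,1,1), of \<nu> 0] by simp
    then show "\<mu> \<le> \<nu>"
      using inner_pos[OF pc(1) \<open>a t \<noteq> 0\<close>] by simp
  qed
  moreover have "0 < inner_w \<phi> \<phi>"
    using inner_pos[OF periodic_solution_continuous[OF \<phi>] nz] .
  ultimately show ?thesis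
    using least[OF \<psi>] \<phi> by (simp add: c_def pos_le_divide_eq)
qed

end

theorem mainTheorem8:
  fixes h \<phi> :: "real \<Rightarrow> real" and l :: int
  assumes "smooth h" and "\<And>t. h (t + 1) = h t" and "\<And>t. h t > 0"
    and "smooth \<phi>" and "\<And>t. \<phi> (t + 1) = \<phi> t" and "\<exists>t. \<phi> t \<noteq> 0"
  shows "first_eigenvalue h l \<le>
    integral {0..1} (\<lambda>t. (2 * pi * of_int l * \<phi> t - deriv \<phi> t)\<^sup>2 / (h t)\<^sup>2) /
    integral {0..1} (\<lambda>t. (h t)\<^sup>2 * (\<phi> t)\<^sup>2)"
proof -
  define c where "c = 2 * pi * real_of_int l"
  obtain h' where h': "\<And>t. (h has_vector_derivative h' t) (at t)" "\<And>k. times_differentiable k h'"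
    using all_times_differentiable_derivative[OF smooth_times_differentiable[OF assms(1)]] by blast
  interpret torus_conformal_factor h h'
    using assms(1-3) h' smooth_times_differentiable
    by unfold_locales (auto simp: has_real_derivative_iff_has_vector_derivative)
  obtain \<phi>' where \<phi>': "\<And>t. (\<phi> has_vector_derivative \<phi>' t) (at t)" "\<And>k. times_differentiable k \<phi>'"
    using all_times_differentiable_derivative[OF smooth_times_differentiable[OF assms(4)]] by blast
  have \<phi>_der: "(\<phi> has_real_derivative \<phi>' t) (at t)" for t
    using \<phi>'(1) by (simp add: has_real_derivative_iff_has_vector_derivative)
  have "isCont \<phi>' t" for t
    using \<phi>'(2)[of "Suc 0"] has_vector_derivative_continuous by fastforce
  then have "continuous_on UNIV \<phi>'"
    by (simp add: continuous_at_imp_continuous_on)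
  then have pc: "\<phi> \<in> periodic_continuous" "\<phi>' \<in> periodic_continuous"
    using DERIV_continuous_on[of UNIV \<phi> \<phi>'] \<phi>_der assms(5) periodic_derivative[OF \<phi>_der]
    by (auto simp: periodic_continuous_def)
  \<comment> \<open>Solving \<phi>' - c \<phi> = h^2 \<psi> for \<psi> makes \<phi> admissible, and
    <\<psi>,\<psi>> becomes the numerator of the claimed bound.\<close>
  define \<psi> where "\<psi> = (\<lambda>t. (\<phi>' t - c * \<phi> t) / (h t)\<^sup>2)"
  have "\<psi> \<in> periodic_continuous"
    using pc w nonzero by (auto simp: periodic_continuous_def \<psi>_def intro!: continuous_intros)
  moreover have "periodic_solution (- c) (\<lambda>t. (h t)\<^sup>2 * \<psi> t) \<phi>"
    using \<phi>_der assms(5) nonzero by (simp add: periodic_solution_def \<psi>_def)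
  moreover obtain t0 where "\<phi> t0 \<noteq> 0" using assms(6) by blast
  ultimately have "first_eigenvalue h l \<le> inner_w \<psi> \<psi> / inner_w \<phi> \<phi>"
    unfolding c_def by (rule first_eigenvalue_le)
  also have "inner_w \<psi> \<psi> = integral {0..1} (\<lambda>t. (2 * pi * of_int l * \<phi> t - deriv \<phi> t)\<^sup>2 / (h t)\<^sup>2)"
    unfolding inner_w_def
  proof (rule integral_cong)
    fix t
    have "(c * \<phi> t - \<phi>' t)\<^sup>2 = (\<phi>' t - c * \<phi> t)\<^sup>2" by (rule power2_commute)
    then show "(h t)\<^sup>2 * \<psi> t * \<psi> t = (2 * pi * of_int l * \<phi> t - deriv \<phi> t)\<^sup>2 / (h t)\<^sup>2"
      using nonzero[of t] DERIV_imp_deriv[OF \<phi>_der, of t]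
      by (simp add: \<psi>_def c_def power2_eq_square)
  qed
  also have "inner_w \<phi> \<phi> = integral {0..1} (\<lambda>t. (h t)\<^sup>2 * (\<phi> t)\<^sup>2)"
    unfolding inner_w_def by (simp add: power2_eq_square mult.assoc)
  finally show ?thesis .
qed

end
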